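(* Let $u_0\in L^\infty(\Omega)$ and let $s_1<s_2$ be real constants with $s_1,s_2\notin(s_*,s^* )$ and $s_1\le u_0(x)\le s_2$ for a.e. $x\in\Omega$. Then: (i) $\omega(u_0)$ is a nonempty compact connected set in $L^1(\Omega)$. (ii) Every $\varphi\in\omega(u_0)$ satisfies $s_1\le\varphi\le s_2$ a.e. in $\Omega$ and is a stationary solution of $(P)$; more precisely, $$f(\varphi(x))-\langle f(\varphi)\rangle=0\quad\text{for a.e. }x\in\Omega.$$
   Context: $\Omega\subset\mathbb{R}^N$ ($N\ge1$) is a (nonempty) bounded open set, $|A|$ is the Lebesgue measure of $A$, and $\langle g\rangle:=\frac1{|\Omega|}\int_\Omega g\,dx$. The function $f:\mathbb{R}\to\mathbb{R}$ satisfies the following. $f\in C^1(\mathbb{R})$ and there are $m<M$ with $f'(m)=f'(M)=0$, $f'<0$ on $(-\infty,m)\cup(M,\infty)$, $f'>0$ on $(m,M)$; and there are $s_*<s^*$ with $s_*<m<M<s^*$, $f(s_* )=f(M)$, $f(s^* )=f(m)$. Problem $(P)$: $\frac{du}{dt}=f(u)-\langle f(u)\rangle$ for $t>0$, $u(0)=u_0$, viewed as an ordinary differential equation in $L^\infty(\Omega)$; for $u_0\in L^\infty(\Omega)$ it has a unique global solution $u\in C^1([0,\infty);L^\infty(\Omega))$. The $\omega$-limit set of $u_0$ is $$\omega(u_0):=\{\varphi\in L^1(\Omega):\ \exists\, t_n\to\infty \text{ with } u(t_n)\to\varphi \text{ in } L^1(\Omega)\text{ as }n\to\infty\}.$$ 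*)

theory Defs
  imports "HOL-Analysis.Analysis" "HOL-Probability.Essential_Supremum"
begin

section \<open>The space \<open>L\<^sup>1\<close> as a metric space of classes modulo a.e. equality\<close>

definition L1_rel :: "'a measure \<Rightarrow> (('a \<Rightarrow> real) \<times> ('a \<Rightarrow> real)) set" where
  "L1_rel \<mu> = {(g, h). integrable \<mu> g \<and> integrable \<mu> h \<and> (AE x in \<mu>. g x = h x)}"

definition L1_space :: "'a measure \<Rightarrow> ('a \<Rightarrow> real) set set" where
  "L1_space \<mu> = {g. integrable \<mu> g} // L1_rel \<mu>"

definition L1_class :: "'a measure \<Rightarrow> ('a \<Rightarrow> real) \<Rightarrow> ('a \<Rightarrow> real) set" where
  "L1_class \<mu> g = L1_rel \<mu> `` {g}"

(* The chosen representatives do not matter, see L1_dist_eq. *)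
definition L1_dist :: "'a measure \<Rightarrow> ('a \<Rightarrow> real) set \<Rightarrow> ('a \<Rightarrow> real) set \<Rightarrow> real" where
  "L1_dist \<mu> A B = (LINT x|\<mu>. \<bar>(SOME g. g \<in> A) x - (SOME h. h \<in> B) x\<bar>)"

definition L1_topology :: "'a measure \<Rightarrow> ('a \<Rightarrow> real) set topology" where
  "L1_topology \<mu> = Metric_space.mtopology (L1_space \<mu>) (L1_dist \<mu>)"

lemma equiv_L1_rel: "equiv {g. integrable \<mu> g} (L1_rel \<mu>)"
proof (rule equivI)
  show "L1_rel \<mu> \<subseteq> {g. integrable \<mu> g} \<times> {g. integrable \<mu> g}"
    by (auto simp: L1_rel_def)
  show "refl_on {g. integrable \<mu> g} (L1_rel \<mu>)"
    by (auto simp: refl_on_def L1_rel_def)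
  show "sym (L1_rel \<mu>)"
    by (auto simp: sym_def L1_rel_def)
  show "trans (L1_rel \<mu>)"
    by (auto simp: trans_def L1_rel_def)
qed

lemma L1_class_in_space: "integrable \<mu> g \<Longrightarrow> L1_class \<mu> g \<in> L1_space \<mu>"
  by (auto simp: L1_class_def L1_space_def quotient_def)

lemma L1_class_self: "integrable \<mu> g \<Longrightarrow> g \<in> L1_class \<mu> g"
  by (auto simp: L1_class_def L1_rel_def)

lemma L1_space_some:
  assumes "A \<in> L1_space \<mu>"
  shows "(SOME g. g \<in> A) \<in> A"
proof -
  have "A \<noteq> {}"
    using assms equiv_L1_rel in_quotient_imp_non_empty unfolding L1_space_def by blast
  then show ?thesis by (simp add: some_in_eq)
qed

lemma L1_space_memD:
  assumes "A \<in> L1_space \<mu>" "g \<in> A" "h \<in> A"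
  shows "integrable \<mu> g" "AE x in \<mu>. g x = h x"
proof -
  have "(g, h) \<in> L1_rel \<mu>"
    using assms quotient_eq_iff[OF equiv_L1_rel, of A \<mu> A g h] unfolding L1_space_def by blast
  then show "integrable \<mu> g" "AE x in \<mu>. g x = h x" by (auto simp: L1_rel_def)
qed

lemma L1_dist_eq:
  assumes "A \<in> L1_space \<mu>" "B \<in> L1_space \<mu>" "g \<in> A" "h \<in> B"
  shows "L1_dist \<mu> A B = (LINT x|\<mu>. \<bar>g x - h x\<bar>)"
proof -
  let ?a = "SOME g. g \<in> A" and ?b = "SOME h. h \<in> B"
  note a = L1_space_some[OF assms(1)] and b = L1_space_some[OF assms(2)]
  have i: "integrable \<mu> ?a" "integrable \<mu> g" "integrable \<mu> ?b" "integrable \<mu> h"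
    using L1_space_memD(1) assms a b by blast+
  have "AE x in \<mu>. ?a x = g x" "AE x in \<mu>. ?b x = h x"
    using L1_space_memD(2) assms a b by blast+
  then have "AE x in \<mu>. \<bar>?a x - ?b x\<bar> = \<bar>g x - h x\<bar>" by eventually_elim simp
  then show ?thesis
    unfolding L1_dist_def using i[THEN borel_measurable_integrable]
    by (intro integral_cong_AE) auto
qed

lemma Metric_space_L1: "Metric_space (L1_space \<mu>) (L1_dist \<mu>)"
proof
  show "0 \<le> L1_dist \<mu> A B" for A B
    by (simp add: L1_dist_def)
  show "L1_dist \<mu> A B = L1_dist \<mu> B A" for A B
    by (simp add: L1_dist_def abs_minus_commute)
next
  fix A B assume AB: "A \<in> L1_space \<mu>" "B \<in> L1_space \<mu>"
  obtain g h where gh: "g \<in> A" "h \<in> B" using L1_space_some AB by blast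
  have i: "integrable \<mu> g" "integrable \<mu> h" using L1_space_memD(1) AB gh by blast+
  have "L1_dist \<mu> A B = 0 \<longleftrightarrow> (AE x in \<mu>. \<bar>g x - h x\<bar> = 0)"
    unfolding L1_dist_eq[OF AB gh] using i
    by (intro integral_nonneg_eq_0_iff_AE) auto
  also have "\<dots> \<longleftrightarrow> (g, h) \<in> L1_rel \<mu>" using i by (simp add: L1_rel_def)
  also have "\<dots> \<longleftrightarrow> A = B"
    using quotient_eq_iff[OF equiv_L1_rel, of A \<mu> B g h] AB gh unfolding L1_space_def by blast
  finally show "L1_dist \<mu> A B = 0 \<longleftrightarrow> A = B" .
next
  fix A B C assume ABC: "A \<in> L1_space \<mu>" "B \<in> L1_space \<mu>" "C \<in> L1_space \<mu>"
  obtain a b c where abc: "a \<in> A" "b \<in> B" "c \<in> C" using L1_space_some ABC by blast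
  have i: "integrable \<mu> a" "integrable \<mu> b" "integrable \<mu> c"
    using L1_space_memD(1) ABC abc by blast+
  have "(LINT x|\<mu>. \<bar>a x - c x\<bar>) \<le> (LINT x|\<mu>. \<bar>a x - b x\<bar> + \<bar>b x - c x\<bar>)"
    using i by (intro integral_mono) auto
  also have "\<dots> = (LINT x|\<mu>. \<bar>a x - b x\<bar>) + (LINT x|\<mu>. \<bar>b x - c x\<bar>)"
    using i by (intro Bochner_Integration.integral_add) auto
  finally show "L1_dist \<mu> A C \<le> L1_dist \<mu> A B + L1_dist \<mu> B C"
    by (simp add: L1_dist_eq[OF ABC(1,3) abc(1,3)] L1_dist_eq[OF ABC(1,2) abc(1,2)]
        L1_dist_eq[OF ABC(2,3) abc(2,3)])
qed

section \<open>The space \<open>L\<^sup>\<infinity>\<close>, by representatives\<close>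

(* Extended-real valued, so that an essentially unbounded function has norm \<infinity>. *)
definition Linf_norm :: "'a measure \<Rightarrow> ('a \<Rightarrow> real) \<Rightarrow> ereal" where
  "Linf_norm \<mu> g = esssup \<mu> (\<lambda>x. ereal \<bar>g x\<bar>)"

definition Linf :: "'a measure \<Rightarrow> ('a \<Rightarrow> real) set" where
  "Linf \<mu> = {g \<in> borel_measurable \<mu>. Linf_norm \<mu> g < \<infinity>}"

definition Linf_tendsto ::
    "'a measure \<Rightarrow> ('i \<Rightarrow> 'a \<Rightarrow> real) \<Rightarrow> ('a \<Rightarrow> real) \<Rightarrow> 'i filter \<Rightarrow> bool" where
  "Linf_tendsto \<mu> U g F \<longleftrightarrow> ((\<lambda>i. Linf_norm \<mu> (\<lambda>x. U i x - g x)) \<longlongrightarrow> 0) F"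

(* Derivative of a curve in L^infinity at t in the norm sense; one-sided at t = 0. *)
definition Linf_has_deriv ::
    "'a measure \<Rightarrow> (real \<Rightarrow> 'a \<Rightarrow> real) \<Rightarrow> ('a \<Rightarrow> real) \<Rightarrow> real \<Rightarrow> bool" where
  "Linf_has_deriv \<mu> u v t \<longleftrightarrow>
     Linf_tendsto \<mu> (\<lambda>s x. (u s x - u t x) / (s - t)) v (at t within {0..})"

section \<open>The nonlocal problem\<close>

definition avg :: "(real ^ 'n) set \<Rightarrow> (real ^ 'n \<Rightarrow> real) \<Rightarrow> real" where
  "avg \<Omega> g = 1 / measure lebesgue \<Omega> * (LINT x|lebesgue_on \<Omega>. g x)"

(* u is a global solution of (P) in C^1([0,\<infinity>); L^infinity(\<Omega>)); v is its derivative.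
   Values u t for t < 0 are irrelevant. *)
definition solves_P ::
    "(real ^ 'n) set \<Rightarrow> (real \<Rightarrow> real) \<Rightarrow> (real ^ 'n \<Rightarrow> real) \<Rightarrow> (real \<Rightarrow> real ^ 'n \<Rightarrow> real) \<Rightarrow> bool"
  where
  "solves_P \<Omega> f u0 u \<longleftrightarrow>
     (\<forall>t\<ge>0. u t \<in> Linf (lebesgue_on \<Omega>)) \<and>
     (\<exists>v. (\<forall>t\<ge>0. v t \<in> Linf (lebesgue_on \<Omega>) \<and>
                  Linf_has_deriv (lebesgue_on \<Omega>) u (v t) t \<and>
                  Linf_tendsto (lebesgue_on \<Omega>) v (v t) (at t within {0..})) \<and>
          (\<forall>t>0. AE x in lebesgue_on \<Omega>. v t x = f (u t x) - avg \<Omega> (\<lambda>y. f (u t y)))) \<and>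
     (AE x in lebesgue_on \<Omega>. u 0 x = u0 x)"

(* The omega-limit set of u0, where u is the solution of (P) starting at u0. *)
definition omega_limit ::
    "(real ^ 'n) set \<Rightarrow> (real \<Rightarrow> real ^ 'n \<Rightarrow> real) \<Rightarrow> (real ^ 'n \<Rightarrow> real) set set" where
  "omega_limit \<Omega> u =
     {\<phi> \<in> L1_space (lebesgue_on \<Omega>). \<exists>t :: nat \<Rightarrow> real.
        (\<forall>n. 0 \<le> t n) \<and> filterlim t at_top sequentially \<and>
        limitin (L1_topology (lebesgue_on \<Omega>))
          (\<lambda>n. L1_class (lebesgue_on \<Omega>) (u (t n))) \<phi> sequentially}"

end

theory Submission
  imports Defs "HOL-Library.Diagonal_Subsequence"
begin

text \<open>The hypothesis on \<open>s\<^sub>1\<close> and \<open>s\<^sub>2\<close> enters only through \<open>f(s) \<le> f(s\<^sub>1)\<close> for \<open>s \<ge> s\<^sub>1\<close> and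
  \<open>f(s) \<ge> f(s\<^sub>2)\<close> for \<open>s \<le> s\<^sub>2\<close>, which make the strip \<open>[s\<^sub>1, s\<^sub>2]\<close> invariant. For almost every \<open>x\<close> the path
  \<open>t \<mapsto> u(t, x)\<close> solves the same scalar equation \<open>y' = f(y) - \<lambda>(t)\<close>, so \<open>u(t, x)\<close> is a monotone function of
  \<open>u\<^sub>0(x)\<close>, and Helly's selection theorem with dominated convergence makes the orbit precompact in
  \<open>L\<^sup>1\<close>. If \<open>F' = f\<close> then the derivative of \<open>\<integral> F(u)\<close> is \<open>\<integral> (f(u) - \<langle>f(u)\<rangle>)\<^sup>2\<close>; as \<open>\<integral> F(u)\<close> is bounded, the
  latter integral tends to \<open>0\<close>.\<close>

section \<open>Barriers and Helly selection\<close>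

text \<open>Two obstacles shape the proof. The equation is posed in L^infinity, so at each time it
  holds only off a null set, and the exceptional sets of uncountably many times cannot be united.
  Hence the solution is first replaced by a version \<open>w\<close> whose paths solve the scalar
  equation at every point; for each time \<open>w t\<close> and \<open>u t\<close> agree almost
  everywhere, so the L^1 classes do not change. The second obstacle is the nonlocal term: the
  constant \<open>s1\<close> is a lower barrier only while the mean of \<open>f\<close> along the
  flow is at most \<open>f s1\<close>, and this is known only when no path lies below
  \<open>s1\<close>. The circle is broken by halving a crude bound on the gap again and again in an
  exponentially weighted norm. Every limit point is stationary because the dissipation tends to 0
  along all times and not merely along some sequence; as in Barbalat's lemma, this comes from a
  Lipschitz estimate in time. Compactness and connectedness are general facts about precompact
  continuous curves in a metric space.\<close>

lemma stays_below_barrier: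
  fixes z z' :: "real \<Rightarrow> real"
  assumes cont: "continuous_on {0..T} z"
    and deriv: "\<And>t. 0 < t \<Longrightarrow> t < T \<Longrightarrow> (z has_real_derivative z' t) (at t)"
    and init: "z 0 \<le> c"
    and above: "\<And>t. 0 < t \<Longrightarrow> t < T \<Longrightarrow> c < z t \<Longrightarrow> z' t \<le> 0"
    and t: "t \<in> {0..T}"
  shows "z t \<le> c"
proof (rule ccontr)
  assume "\<not> z t \<le> c"
  then have ztc: "c < z t" by simp
  let ?S = "{0..t} \<inter> z -` {..c}"
  have "continuous_on {0..t} z" using cont by (rule continuous_on_subset) (use t in auto)
  then have "closed ?S"
    using continuous_closed_preimage[of "{0..t}" z "{..c}"] by (simp add: closed_atMost)
  moreover have "bounded ?S" by (rule bounded_subset[OF bounded_closed_interval]) auto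
  ultimately have "compact ?S" by (simp add: compact_eq_bounded_closed)
  moreover have "0 \<in> ?S" using init t by simp
  \<comment> \<open>\<open>r\<close> is the last time up to \<open>t\<close> at which
    \<open>z\<close> is at most \<open>c\<close>. After it the sign condition on \<open>z'\<close>
    applies throughout, so a single use of the mean value theorem gives
    \<open>z t \<le> z r\<close>.\<close>
  ultimately obtain r where r: "r \<in> ?S" "\<And>s. s \<in> ?S \<Longrightarrow> s \<le> r"
    using compact_attains_sup[of ?S] by blast
  have rt: "0 \<le> r" "r \<le> t" "z r \<le> c" using r(1) by auto
  then have "r < t" using ztc by (cases "r = t") auto
  have ab: "c < z s" if "r < s" "s \<le> t" for s
  proof (rule ccontr)
    assume "\<not> c < z s"
    then have "s \<in> ?S" using that r(1) by simp
    then show False using r(2)[of s] that(1) by linarith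
  qed
  have cont': "continuous_on {r..t} z" using cont by (rule continuous_on_subset) (use t rt in auto)
  have deriv': "(z has_real_derivative z' s) (at s)" if "r < s" "s < t" for s
    by (rule deriv) (use that rt t in auto)
  then have diff: "z differentiable (at s)" if "r < s" "s < t" for s
    unfolding real_differentiable_def using that by blast
  obtain l s where s: "r < s" "s < t" "(z has_real_derivative l) (at s)" "z t - z r = (t - r) * l"
    using MVT[OF \<open>r < t\<close> cont' diff] by blast
  then have "l = z' s" using DERIV_unique[OF _ deriv'] by blast
  then have "l \<le> 0" using above[of s] ab[of s] s rt t by auto
  then have "z t \<le> z r" using s(4) \<open>r < t\<close> mult_nonneg_nonpos[of "t - r" l] by simp
  then show False using rt ztc \<open>r < t\<close> ab[of t] by auto
qed

lemma C1_lipschitz_on_interval: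
  fixes f f' :: "real \<Rightarrow> real"
  assumes "\<And>s. (f has_real_derivative f' s) (at s)" and "continuous_on UNIV f'"
  obtains L where "0 < L" "\<And>x y. x \<in> {a..b} \<Longrightarrow> y \<in> {a..b} \<Longrightarrow> \<bar>f x - f y\<bar> \<le> L * \<bar>x - y\<bar>"
proof -
  have "bounded (f' ` {a..b})"
    by (intro compact_imp_bounded compact_continuous_image continuous_on_subset[OF assms(2)]) auto
  then obtain B where B: "B > 0" "\<And>s. s \<in> {a..b} \<Longrightarrow> \<bar>f' s\<bar> \<le> B"
    unfolding bounded_pos by auto
  have "norm (f x - f y) \<le> B * norm (x - y)" if "x \<in> {a..b}" "y \<in> {a..b}" for x y
    by (rule field_differentiable_bound[of "{a..b}" f f' B])
      (use B that assms(1) in \<open>auto intro: has_field_derivative_at_within\<close>)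
  then show ?thesis using B that by auto
qed

text \<open>Cantor's diagonal argument: Bolzano-Weierstrass refines the sequence at one point of an
  enumeration of \<open>D\<close> after another.\<close>

lemma pointwise_convergent_subsequence:
  fixes g :: "nat \<Rightarrow> 'a \<Rightarrow> real"
  assumes "countable D" and "\<And>n x. x \<in> D \<Longrightarrow> g n x \<in> {a..b}"
  obtains r :: "nat \<Rightarrow> nat" where "strict_mono r" "\<And>x. x \<in> D \<Longrightarrow> convergent (\<lambda>n. g (r n) x)"
proof (cases "D = {}")
  case True
  then show ?thesis using that[of id] by (auto simp: strict_mono_def)
next
  case False
  define d where "d = from_nat_into D"
  have d: "d n \<in> D" for n using False by (simp add: d_def from_nat_into)
  interpret subseqs "\<lambda>n s. convergent (\<lambda>k. g (s k) (d n))"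
  proof
    fix n :: nat and s :: "nat \<Rightarrow> nat" assume "strict_mono s"
    have "seq_compact {a..b}" using compact_Icc compact_imp_seq_compact by blast
    moreover have "\<forall>k. g (s k) (d n) \<in> {a..b}" using assms(2)[OF d] by blast
    ultimately obtain l r where "strict_mono r" "((\<lambda>k. g (s k) (d n)) \<circ> r) \<longlonglongrightarrow> l"
      by (rule seq_compactE)
    then show "\<exists>r'. strict_mono r' \<and> convergent (\<lambda>k. g ((s \<circ> r') k) (d n))"
      unfolding convergent_def comp_def by auto
  qed
  \<comment> \<open>The diagonal sequence is a subsequence of the refinement made for
    \<open>d n\<close> only from index \<open>Suc n\<close> on; the shift is removed below because
    convergence ignores initial segments.\<close>
  have diag: "convergent (\<lambda>k. g ((diagseq \<circ> (+) (Suc n)) k) (d n))" for n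
    by (rule diagseq_holds) (auto simp: comp_def dest: convergent_subseq_convergent)
  have shift: "(\<lambda>k. g ((diagseq \<circ> (+) (Suc n)) k) (d n)) = (\<lambda>k. g (diagseq (k + Suc n)) (d n))" for n
    unfolding comp_def by (subst add.commute) (rule refl)
  have "convergent (\<lambda>k. g (diagseq (k + Suc n)) (d n))" for n
    using diag[of n] unfolding shift .
  then have conv: "convergent (\<lambda>k. g (diagseq k) (d n))" for n
    using convergent_ignore_initial_segment[of "\<lambda>k. g (diagseq k) (d n)" "Suc n"] by simp
  show ?thesis
  proof (rule that[OF subseq_diagseq])
    fix x assume "x \<in> D"
    then obtain n where "x = d n" using from_nat_into_surj[OF assms(1)] unfolding d_def by metis
    with conv show "convergent (\<lambda>k. g (diagseq k) x)" by simp
  qed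
qed

text \<open>The limit of a subsequence converging on the rationals has countably many discontinuities;
  these are handled by a second extraction.\<close>

lemma Helly_selection_everywhere:
  fixes Y :: "nat \<Rightarrow> real \<Rightarrow> real"
  assumes mono: "\<And>n. mono (Y n)" and bd: "\<And>n s. Y n s \<in> {a..b}"
  obtains r :: "nat \<Rightarrow> nat" where "strict_mono r" "\<And>s. convergent (\<lambda>n. Y (r n) s)"
proof -
  obtain r1 :: "nat \<Rightarrow> nat" where r1: "strict_mono r1" "\<And>q. q \<in> \<rat> \<Longrightarrow> convergent (\<lambda>n. Y (r1 n) q)"
    using pointwise_convergent_subsequence[of \<rat> Y a b] bd countable_rat by blast
  define g where "g q = lim (\<lambda>n. Y (r1 n) q)" for q
  have g: "(\<lambda>n. Y (r1 n) q) \<longlonglongrightarrow> g q" if "q \<in> \<rat>" for q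
    using r1(2)[OF that] by (simp add: g_def convergent_LIMSEQ_iff)
  have g_mono: "g p \<le> g q" if "p \<in> \<rat>" "q \<in> \<rat>" "p \<le> q" for p q
    by (rule LIMSEQ_le[OF g g]) (use that mono in \<open>auto dest: monoD\<close>)
  have g_bd: "g q \<le> b" if "q \<in> \<rat>" for q
    by (rule LIMSEQ_le_const2[OF g[OF that]]) (use bd in auto)
  \<comment> \<open>\<open>G\<close> extends \<open>g\<close> from the rationals to a monotone
    function on the whole line, whose discontinuities are therefore countable.\<close>
  define G where "G s = (SUP q\<in>{q\<in>\<rat>. q \<le> s}. g q)" for s
  have ne: "{q\<in>\<rat>. q \<le> s} \<noteq> {}" for s :: real
    using Rats_dense_in_real[of "s - 1" s] by auto
  have bdd: "bdd_above (g ` {q\<in>\<rat>. q \<le> s})" for s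
    using g_bd by (auto simp: bdd_above_def)
  have "mono G"
    unfolding G_def by (intro monoI cSUP_subset_mono ne bdd) auto
  have G_rat: "G q = g q" if "q \<in> \<rat>" for q
    unfolding G_def by (intro cSup_eq_maximum) (use that g_mono in auto)
  have conv: "convergent (\<lambda>n. Y (r1 n) s)" if cont: "isCont G s" for s
  proof -
    have "(\<lambda>n. Y (r1 n) s) \<longlonglongrightarrow> G s"
    proof (rule LIMSEQ_I)
      fix e :: real assume "0 < e"
      then obtain d where d: "d > 0" "\<And>x. \<bar>x - s\<bar> < d \<Longrightarrow> \<bar>G x - G s\<bar> < e"
        using cont unfolding continuous_at_eps_delta by (auto simp: dist_real_def)
      \<comment> \<open>Monotonicity squeezes \<open>Y (r1 n) s\<close> between its values at the
        rationals \<open>p < s < q\<close>, whose limits lie within \<open>e\<close> of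
        \<open>G s\<close>.\<close>
      obtain p where p: "p \<in> \<rat>" "s - d < p" "p < s" using Rats_dense_in_real[of "s - d" s] d by auto
      obtain q where q: "q \<in> \<rat>" "s < q" "q < s + d" using Rats_dense_in_real[of s "s + d"] d by auto
      have "\<bar>g p - G s\<bar> < e" "\<bar>g q - G s\<bar> < e" using d(2)[of p] d(2)[of q] p q G_rat by auto
      then have "g p > G s - e" "g q < G s + e" by auto
      then have "\<forall>\<^sub>F n in sequentially. Y (r1 n) p > G s - e" "\<forall>\<^sub>F n in sequentially. Y (r1 n) q < G s + e"
        using g[OF p(1)] g[OF q(1)] order_tendstoD by blast+
      then have "\<forall>\<^sub>F n in sequentially. norm (Y (r1 n) s - G s) < e"
      proof eventually_elim
        case (elim n)
        then show ?case using monoD[OF mono, of p s "r1 n"] monoD[OF mono, of s q "r1 n"] p q by auto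
      qed
      then show "\<exists>no. \<forall>n\<ge>no. norm (Y (r1 n) s - G s) < e" by (simp add: eventually_sequentially)
    qed
    then show ?thesis by (auto simp: convergent_def)
  qed
  \<comment> \<open>The exceptional levels cannot be dropped: the levels will be initial values
    \<open>w 0 x\<close>, and a single one may be attained on a set of positive measure.\<close>
  obtain r2 :: "nat \<Rightarrow> nat" where r2: "strict_mono r2"
      "\<And>s. s \<in> {s. \<not> isCont G s} \<Longrightarrow> convergent (\<lambda>n. Y (r1 (r2 n)) s)"
    using pointwise_convergent_subsequence[of "{s. \<not> isCont G s}" "\<lambda>n. Y (r1 n)" a b]
      bd mono_ctble_discont[OF \<open>mono G\<close>] by blast
  have "convergent (\<lambda>n. Y (r1 (r2 n)) s)" for s
    using convergent_subseq_convergent[OF conv r2(1), of s] r2(2)[of s] by (cases "isCont G s") (auto simp: comp_def)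
  then show ?thesis using that[OF strict_mono_o[OF r1(1) r2(1)]] by (simp add: comp_def)
qed

section \<open>Curves in \<open>L\<^sup>\<infinity>\<close>\<close>

lemma Linf_tendsto_AE:
  assumes "Linf_tendsto \<mu> U g F" "0 < e"
  shows "\<forall>\<^sub>F i in F. AE x in \<mu>. \<bar>U i x - g x\<bar> \<le> e"
proof -
  have "\<forall>\<^sub>F i in F. Linf_norm \<mu> (\<lambda>x. U i x - g x) < ereal e"
    using assms order_tendstoD(2)[of _ "0::ereal" F "ereal e"] unfolding Linf_tendsto_def by simp
  then show ?thesis
  proof eventually_elim
    case (elim i)
    have "AE x in \<mu>. ereal \<bar>U i x - g x\<bar> \<le> Linf_norm \<mu> (\<lambda>x. U i x - g x)"
      unfolding Linf_norm_def by (rule esssup_AE)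
    then show ?case
    proof eventually_elim
      case (elim x)
      then have "ereal \<bar>U i x - g x\<bar> < ereal e"
        using \<open>Linf_norm \<mu> (\<lambda>x. U i x - g x) < ereal e\<close> by (rule le_less_trans)
      then show ?case by simp
    qed
  qed
qed

lemma Linf_AE_bounded:
  assumes "g \<in> Linf \<mu>"
  obtains C where "AE x in \<mu>. \<bar>g x\<bar> \<le> C"
proof -
  obtain C where C: "Linf_norm \<mu> g \<le> ereal C"
    using assms unfolding Linf_def by (cases "Linf_norm \<mu> g") auto
  have "AE x in \<mu>. ereal \<bar>g x\<bar> \<le> Linf_norm \<mu> g"
    unfolding Linf_norm_def by (rule esssup_AE)
  then have "AE x in \<mu>. \<bar>g x\<bar> \<le> C"
    by eventually_elim (metis C ereal_less_eq(3) order_trans)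
  then show ?thesis by (rule that)
qed

section \<open>Almost everywhere bounds obtained from integrals over measurable sets\<close>

context finite_measure
begin

lemma integrable_Linf: "g \<in> Linf M \<Longrightarrow> integrable M g"
  using Linf_AE_bounded[of g M] integrable_const_bound[of g] unfolding Linf_def by auto

text \<open>Test with the set where \<open>h\<close> exceeds \<open>c\<close>: there
  \<open>h - c\<close> is positive with integral at most 0. This turns scalar estimates, one for
  each measurable set, back into pointwise ones.\<close>

lemma AE_le_if_set_integral_le:
  assumes h: "integrable M h"
    and le: "\<And>A. A \<in> sets M \<Longrightarrow> (LINT x|M. indicator A x * h x) \<le> c * measure M A"
  shows "AE x in M. h x \<le> c"
proof -
  have [measurable]: "h \<in> borel_measurable M" using h by simp
  define A where "A = {x \<in> space M. c < h x}"
  have [measurable]: "A \<in> sets M" unfolding A_def by measurable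
  have i: "integrable M (\<lambda>x. indicator A x * h x)" "integrable M (\<lambda>x. indicator A x * c)"
    using h by (auto intro!: integrable_real_mult_indicator simp: mult.commute emeasure_eq_measure)
  have eq: "indicator A x * (h x - c) = indicator A x * h x - indicator A x * c" for x
    by (simp add: algebra_simps)
  have "(LINT x|M. indicator A x * (h x - c)) = (LINT x|M. indicator A x * h x) - measure M A * c"
    unfolding eq using i by (subst Bochner_Integration.integral_diff) auto
  then have "(LINT x|M. indicator A x * (h x - c)) \<le> 0"
    using le[of A] by (simp add: mult.commute)
  moreover have nn: "AE x in M. 0 \<le> indicator A x * (h x - c)"
    by (auto simp: A_def indicator_def)
  moreover have "integrable M (\<lambda>x. indicator A x * (h x - c))"
    unfolding eq using i by auto
  ultimately have "AE x in M. indicator A x * (h x - c) = 0"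
    using integral_nonneg_AE[OF nn] integral_nonneg_eq_0_iff_AE[OF _ nn] by linarith
  then show ?thesis
    by (rule AE_mp) (auto simp: A_def indicator_def not_less[symmetric])
qed

lemma AE_abs_le_if_set_integral_le:
  assumes h: "integrable M h"
    and le: "\<And>A. A \<in> sets M \<Longrightarrow> \<bar>LINT x|M. indicator A x * h x\<bar> \<le> c * measure M A"
  shows "AE x in M. \<bar>h x\<bar> \<le> c"
proof -
  have "AE x in M. h x \<le> c"
    by (rule AE_le_if_set_integral_le[OF h]) (use le in \<open>auto simp: abs_le_iff\<close>)
  moreover have "AE x in M. - h x \<le> c"
    by (rule AE_le_if_set_integral_le) (use h le in \<open>auto simp: abs_le_iff\<close>)
  ultimately show ?thesis by eventually_elim auto
qed

lemma abs_set_integral_le: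
  assumes g: "integrable M g" and le: "AE x in M. \<bar>g x\<bar> \<le> c" and A: "A \<in> sets M"
  shows "\<bar>LINT x|M. indicator A x * g x\<bar> \<le> c * measure M A"
proof -
  have "\<bar>LINT x|M. indicator A x * g x\<bar> \<le> (LINT x|M. \<bar>indicator A x * g x\<bar>)"
    by (rule integral_abs_bound)
  also have "\<dots> \<le> (LINT x|M. indicator A x * c)"
  proof (rule integral_mono_AE)
    show "integrable M (\<lambda>x. \<bar>indicator A x * g x\<bar>)"
      using integrable_real_mult_indicator[OF A g] by (simp add: mult.commute)
    show "integrable M (\<lambda>x. indicator A x * c)"
      using A by (auto simp: emeasure_eq_measure)
    show "AE x in M. \<bar>indicator A x * g x\<bar> \<le> indicator A x * c"
      using le by eventually_elim (auto simp: indicator_def)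
  qed
  also have "\<dots> = c * measure M A" using A by simp
  finally show ?thesis .
qed

text \<open>The mean value theorem is applied to the integral of the curve over an arbitrary measurable
  set, which avoids vector-valued calculus.\<close>

lemma Linf_C1_strict_derivative:
  assumes u: "\<And>t. 0 \<le> t \<Longrightarrow> u t \<in> Linf M"
    and v: "\<And>t. 0 \<le> t \<Longrightarrow> v t \<in> Linf M"
    and deriv: "\<And>t. 0 \<le> t \<Longrightarrow> Linf_has_deriv M u (v t) t"
    and cont: "\<And>t. 0 \<le> t \<Longrightarrow> Linf_tendsto M v (v t) (at t within {0..})"
    and "0 \<le> t" "0 < e"
  shows "\<exists>d>0. \<forall>r\<ge>0. \<forall>s\<ge>0. \<bar>r - t\<bar> < d \<longrightarrow> \<bar>s - t\<bar> < d \<longrightarrow>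
      (AE x in M. \<bar>u s x - u r x - (s - r) * v r x\<bar> \<le> e * \<bar>s - r\<bar>)"
proof -
  note iu = integrable_Linf[OF u] and iv = integrable_Linf[OF v]
  \<comment> \<open>The bound \<open>e / 2\<close> against \<open>v t\<close> makes any two
    derivatives taken at times within \<open>d\<close> of \<open>t\<close> differ by at most
    \<open>e\<close>.\<close>
  obtain d where d: "0 < d" "\<And>r. 0 \<le> r \<Longrightarrow> \<bar>r - t\<bar> < d \<Longrightarrow> r \<noteq> t \<Longrightarrow> AE x in M. \<bar>v r x - v t x\<bar> \<le> e / 2"
    using Linf_tendsto_AE[OF cont[OF \<open>0 \<le> t\<close>], of "e / 2"] \<open>0 < e\<close>
    unfolding eventually_at by (auto simp: dist_real_def)
  have vt: "AE x in M. \<bar>v r x - v t x\<bar> \<le> e / 2" if "0 \<le> r" "\<bar>r - t\<bar> < d" for r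
    using d(2)[OF that] \<open>0 < e\<close> by (cases "r = t") auto
  have vv: "AE x in M. \<bar>v q x - v r x\<bar> \<le> e" if "0 \<le> r" "\<bar>r - t\<bar> < d" "0 \<le> q" "\<bar>q - t\<bar> < d" for r q
    using vt[OF that(1,2)] vt[OF that(3,4)] by eventually_elim linarith
  have main: "AE x in M. \<bar>u s x - u r x - (s - r) * v r x\<bar> \<le> e * \<bar>s - r\<bar>"
    if rs: "0 \<le> r" "0 \<le> s" "\<bar>r - t\<bar> < d" "\<bar>s - t\<bar> < d" for r s
  proof (rule AE_abs_le_if_set_integral_le)
    show "integrable M (\<lambda>x. u s x - u r x - (s - r) * v r x)"
      using iu iv rs by auto
    fix A assume A[measurable]: "A \<in> sets M"
    have ind: "integrable M (\<lambda>x. indicator A x * g x)" if "integrable M g" for g :: "_ \<Rightarrow> real"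
      using integrable_real_mult_indicator[OF A that] by (simp add: mult.commute)
    define \<phi> where "\<phi> q = (LINT x|M. indicator A x * u q x)" for q
    define \<psi> where "\<psi> q = (LINT x|M. indicator A x * v q x)" for q
    have der: "(\<phi> has_real_derivative \<psi> q) (at q within {0..})" if q: "0 \<le> q" for q
      unfolding has_field_derivative_iff
    proof (rule tendstoI)
      fix \<epsilon> :: real assume "0 < \<epsilon>"
      \<comment> \<open>The summand 1 keeps the denominator positive when \<open>A\<close> is a null
        set.\<close>
      define \<eta> where "\<eta> = \<epsilon> / (measure M A + 1)"
      have p: "0 < measure M A + 1" using measure_nonneg[of M A] by linarith
      have "0 < \<eta>" using \<open>0 < \<epsilon>\<close> p by (simp add: \<eta>_def)
      have "\<eta> * (measure M A + 1) = \<epsilon>" using p by (simp add: \<eta>_def)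
      then have "\<eta> * measure M A < \<epsilon>" using \<open>0 < \<eta>\<close> by (simp add: distrib_left)
      have "\<forall>\<^sub>F y in at q within {0..}. AE x in M. \<bar>(u y x - u q x) / (y - q) - v q x\<bar> \<le> \<eta>"
        using deriv[OF q] Linf_tendsto_AE[OF _ \<open>0 < \<eta>\<close>] unfolding Linf_has_deriv_def by blast
      moreover have "\<forall>\<^sub>F y in at q within {0..}. y \<in> {0..} \<and> y \<noteq> q"
        by (auto simp: eventually_at_filter)
      ultimately show "\<forall>\<^sub>F y in at q within {0..}. dist ((\<phi> y - \<phi> q) / (y - q)) (\<psi> q) < \<epsilon>"
      proof eventually_elim
        case (elim y)
        then have y: "0 \<le> y" by simp
        let ?k = "\<lambda>x. (u y x - u q x) / (y - q) - v q x"
        have "(\<phi> y - \<phi> q) / (y - q) - \<psi> q = (LINT x|M. indicator A x * ?k x)"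
        proof -
          have "(LINT x|M. indicator A x * ?k x)
              = (LINT x|M. (indicator A x * u y x - indicator A x * u q x) / (y - q) - indicator A x * v q x)"
            by (intro Bochner_Integration.integral_cong) (auto simp: algebra_simps diff_divide_distrib)
          also have "\<dots> = (\<phi> y - \<phi> q) / (y - q) - \<psi> q"
            unfolding \<phi>_def \<psi>_def using ind[OF iu[OF y]] ind[OF iu[OF q]] ind[OF iv[OF q]] by simp
          finally show ?thesis by simp
        qed
        also have "\<bar>\<dots>\<bar> \<le> \<eta> * measure M A"
          by (rule abs_set_integral_le[OF _ _ A]) (use elim iu[OF y] iu[OF q] iv[OF q] in auto)
        finally show ?case using \<open>\<eta> * measure M A < \<epsilon>\<close> by (simp add: dist_real_def)
      qed
    qed
    have mean: "\<exists>q. 0 \<le> q \<and> \<bar>q - t\<bar> < d \<and> \<phi> b - \<phi> a = (b - a) * \<psi> q"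
      if ab: "a < b" "0 \<le> a" "\<bar>a - t\<bar> < d" "\<bar>b - t\<bar> < d" for a b
    proof -
      have "(\<phi> has_derivative (*) (\<psi> q)) (at q within {a..b})" if "a \<le> q" "q \<le> b" for q
        using DERIV_subset[OF der, of q "{a..b}"] that ab unfolding has_field_derivative_def by auto
      then obtain q where "q \<in> {a<..<b}" "\<phi> b - \<phi> a = \<psi> q * (b - a)"
        using mvt_simple[OF ab(1), of \<phi> "\<lambda>q. (*) (\<psi> q)"] by blast
      then show ?thesis using ab by (intro exI[of _ q]) auto
    qed
    obtain q where q: "0 \<le> q" "\<bar>q - t\<bar> < d" "\<phi> s - \<phi> r = (s - r) * \<psi> q"
    proof (cases r s rule: linorder_cases)
      case less
      then show ?thesis using mean[of r s] rs that by blast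
    next
      case equal
      then show ?thesis using rs that[of r] by simp
    next
      case greater
      then obtain q where "0 \<le> q" "\<bar>q - t\<bar> < d" "\<phi> r - \<phi> s = (r - s) * \<psi> q" using mean[of s r] rs by blast
      then show ?thesis by (intro that[of q]) (auto simp: algebra_simps)
    qed
    have "(LINT x|M. indicator A x * (u s x - u r x - (s - r) * v r x))
        = (LINT x|M. indicator A x * u s x - indicator A x * u r x - (s - r) * (indicator A x * v r x))"
      by (intro Bochner_Integration.integral_cong) (auto simp: algebra_simps)
    also have "\<dots> = \<phi> s - \<phi> r - (s - r) * \<psi> r"
      unfolding \<phi>_def \<psi>_def using ind[OF iu[OF rs(2)]] ind[OF iu[OF rs(1)]] ind[OF iv[OF rs(1)]] by simp
    also have "\<dots> = (s - r) * (\<psi> q - \<psi> r)" using q by (simp add: algebra_simps)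
    \<comment> \<open>The mean value time \<open>q\<close> depends on \<open>A\<close>, but
      \<open>vv\<close> bounds \<open>v q - v r\<close> by \<open>e\<close> for every admissible
      \<open>q\<close>. So the final estimate is uniform in \<open>A\<close>, as the passage to an
      almost everywhere bound requires.\<close>
    also have "\<psi> q - \<psi> r = (LINT x|M. indicator A x * (v q x - v r x))"
      unfolding \<psi>_def using ind[OF iv[OF q(1)]] ind[OF iv[OF rs(1)]] by (simp add: right_diff_distrib)
    finally have "\<bar>LINT x|M. indicator A x * (u s x - u r x - (s - r) * v r x)\<bar>
        = \<bar>s - r\<bar> * \<bar>LINT x|M. indicator A x * (v q x - v r x)\<bar>"
      by (simp add: abs_mult)
    also have "\<dots> \<le> \<bar>s - r\<bar> * (e * measure M A)"
      by (intro mult_left_mono abs_set_integral_le[OF _ vv A]) (use q rs iv in auto)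
    finally show "\<bar>LINT x|M. indicator A x * (u s x - u r x - (s - r) * v r x)\<bar> \<le> e * \<bar>s - r\<bar> * measure M A"
      by (simp add: mult_ac)
  qed
  show ?thesis using d(1) main by blast
qed

end

section \<open>A pathwise version of the solution\<close>

text \<open>Rounding down to multiples of \<open>1 / (n + 1)\<close> keeps nonnegative times
  nonnegative and fixes time 0. The approximating times do not depend on the point \<open>x\<close>,
  so limits along them are measurable in \<open>x\<close>.\<close>

definition rat_below :: "nat \<Rightarrow> real \<Rightarrow> real" where
  "rat_below n t = real_of_int \<lfloor>t * real (Suc n)\<rfloor> / real (Suc n)"

lemma rat_below_in: "0 \<le> t \<Longrightarrow> rat_below n t \<in> \<rat> \<inter> {0..}"
  unfolding rat_below_def by (auto intro!: divide_nonneg_pos Rats_divide)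

lemma rat_below_tendsto: "(\<lambda>n. rat_below n t) \<longlonglongrightarrow> t"
proof (rule tendsto_sandwich)
  have "t - 1 / real (Suc n) \<le> rat_below n t \<and> rat_below n t \<le> t" for n
  proof -
    have "t * real (Suc n) - 1 \<le> real_of_int \<lfloor>t * real (Suc n)\<rfloor>" "real_of_int \<lfloor>t * real (Suc n)\<rfloor> \<le> t * real (Suc n)"
      by linarith+
    then show ?thesis unfolding rat_below_def
      by (simp add: pos_le_divide_eq pos_divide_le_eq left_diff_distrib del: of_nat_Suc)
  qed
  then show "\<forall>\<^sub>F n in sequentially. t - 1 / real (Suc n) \<le> rat_below n t"
    "\<forall>\<^sub>F n in sequentially. rat_below n t \<le> t" by auto
  show "(\<lambda>n. t - 1 / real (Suc n)) \<longlonglongrightarrow> t"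
    using tendsto_diff[OF tendsto_const[of t] LIMSEQ_Suc[OF lim_1_over_n]] by simp
qed simp

lemma rat_below_near:
  assumes "\<bar>s - t\<bar> < d"
  shows "\<forall>\<^sub>F n in sequentially. \<bar>rat_below n s - t\<bar> < d"
proof -
  have "(\<lambda>n. \<bar>rat_below n s - t\<bar>) \<longlonglongrightarrow> \<bar>s - t\<bar>"
    by (intro tendsto_intros rat_below_tendsto)
  then show ?thesis using assms order_tendstoD(2) by blast
qed

text \<open>Estimates that hold almost everywhere can be imposed simultaneously at countably many times
  only, hence paths are recovered from their values at rational times.\<close>

locale rational_curves =
  fixes U V :: "real \<Rightarrow> 'b \<Rightarrow> real"
  assumes bounded: "\<And>t. 0 \<le> t \<Longrightarrow> \<exists>d>0. \<exists>C. \<forall>r\<in>\<rat> \<inter> {0..}. \<bar>r - t\<bar> < d \<longrightarrow> (\<forall>x. \<bar>U r x\<bar> \<le> C \<and> \<bar>V r x\<bar> \<le> C)"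
    and strict: "\<And>t e. 0 \<le> t \<Longrightarrow> 0 < e \<Longrightarrow> \<exists>d>0. \<forall>r\<in>\<rat> \<inter> {0..}. \<forall>s\<in>\<rat> \<inter> {0..}.
      \<bar>r - t\<bar> < d \<longrightarrow> \<bar>s - t\<bar> < d \<longrightarrow> (\<forall>x. \<bar>U s x - U r x - (s - r) * V r x\<bar> \<le> e * \<bar>s - r\<bar>)"
begin

definition ext :: "real \<Rightarrow> 'b \<Rightarrow> real" where
  "ext t x = lim (\<lambda>n. U (rat_below n t) x)"

lemma locally_Lipschitz_rational:
  assumes "0 \<le> t"
  obtains d C where "0 < d" "\<And>r x. r \<in> \<rat> \<inter> {0..} \<Longrightarrow> \<bar>r - t\<bar> < d \<Longrightarrow> \<bar>U r x\<bar> \<le> C"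
    "\<And>r s x. r \<in> \<rat> \<inter> {0..} \<Longrightarrow> s \<in> \<rat> \<inter> {0..} \<Longrightarrow> \<bar>r - t\<bar> < d \<Longrightarrow> \<bar>s - t\<bar> < d \<Longrightarrow>
      \<bar>U s x - U r x\<bar> \<le> C * \<bar>s - r\<bar>"
proof -
  obtain d1 C where d1: "0 < d1" "\<forall>r\<in>\<rat> \<inter> {0..}. \<bar>r - t\<bar> < d1 \<longrightarrow> (\<forall>x. \<bar>U r x\<bar> \<le> C \<and> \<bar>V r x\<bar> \<le> C)"
    using bounded[OF assms] by blast
  obtain d2 where d2: "0 < d2" "\<forall>r\<in>\<rat> \<inter> {0..}. \<forall>s\<in>\<rat> \<inter> {0..}.
      \<bar>r - t\<bar> < d2 \<longrightarrow> \<bar>s - t\<bar> < d2 \<longrightarrow> (\<forall>x. \<bar>U s x - U r x - (s - r) * V r x\<bar> \<le> 1 * \<bar>s - r\<bar>)"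
    using strict[OF assms, of 1] by (meson zero_less_one)
  show ?thesis
  \<comment> \<open>\<open>C\<close> bounds \<open>V\<close>, and the additional 1 is the error
    allowed by \<open>strict\<close> with \<open>e = 1\<close>.\<close>
  proof (rule that[of "min d1 d2" "C + 1"])
    show "0 < min d1 d2" using d1 d2 by simp
    show "\<bar>U r x\<bar> \<le> C + 1" if "r \<in> \<rat> \<inter> {0..}" "\<bar>r - t\<bar> < min d1 d2" for r x
    proof -
      have "\<bar>U r x\<bar> \<le> C" using d1(2) that by auto
      then show ?thesis by simp
    qed
    show "\<bar>U s x - U r x\<bar> \<le> (C + 1) * \<bar>s - r\<bar>"
      if rs: "r \<in> \<rat> \<inter> {0..}" "s \<in> \<rat> \<inter> {0..}" "\<bar>r - t\<bar> < min d1 d2" "\<bar>s - t\<bar> < min d1 d2" for r s x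
    proof -
      have "\<bar>U s x - U r x - (s - r) * V r x\<bar> \<le> 1 * \<bar>s - r\<bar>" using d2(2) rs by simp
      moreover have "\<bar>(s - r) * V r x\<bar> \<le> C * \<bar>s - r\<bar>"
        using d1(2) rs mult_left_mono[of "\<bar>V r x\<bar>" C "\<bar>s - r\<bar>"] by (simp add: abs_mult mult.commute)
      ultimately show ?thesis by (simp add: distrib_right)
    qed
  qed
qed

lemma ext_tendsto:
  assumes "0 \<le> t"
  shows "(\<lambda>n. U (rat_below n t) x) \<longlonglongrightarrow> ext t x"
proof -
  obtain d C where d: "0 < d"
    "\<And>r s x. r \<in> \<rat> \<inter> {0..} \<Longrightarrow> s \<in> \<rat> \<inter> {0..} \<Longrightarrow> \<bar>r - t\<bar> < d \<Longrightarrow> \<bar>s - t\<bar> < d \<Longrightarrow>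
      \<bar>U s x - U r x\<bar> \<le> C * \<bar>s - r\<bar>"
    using locally_Lipschitz_rational[OF assms] by metis
  have "Cauchy (\<lambda>n. U (rat_below n t) x)"
  proof (rule metric_CauchyI)
    fix e :: real assume "0 < e"
    \<comment> \<open>Two times within \<open>h\<close> of \<open>t\<close> are less than
      \<open>2 * h\<close> apart, which the Lipschitz bound turns into less than \<open>e\<close>;
      \<open>\<bar>C\<bar> + 1\<close> avoids division by 0.\<close>
    define h where "h = min d (e / (2 * (\<bar>C\<bar> + 1)))"
    have "0 < h" using \<open>0 < e\<close> d(1) by (simp add: h_def)
    obtain N where N: "\<And>n. n \<ge> N \<Longrightarrow> \<bar>rat_below n t - t\<bar> < h"
      using rat_below_near[of t t h] \<open>0 < h\<close> by (auto simp: eventually_sequentially)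
    have "dist (U (rat_below m t) x) (U (rat_below n t) x) < e" if "m \<ge> N" "n \<ge> N" for m n
    proof -
      have "\<bar>U (rat_below m t) x - U (rat_below n t) x\<bar> \<le> C * \<bar>rat_below m t - rat_below n t\<bar>"
        using d(2)[OF rat_below_in rat_below_in] N[OF that(1)] N[OF that(2)] assms by (simp add: h_def)
      also have "\<dots> \<le> \<bar>C\<bar> * \<bar>rat_below m t - rat_below n t\<bar>" by (intro mult_right_mono) auto
      also have "\<dots> \<le> \<bar>C\<bar> * (2 * h)" using N[OF that(1)] N[OF that(2)] by (intro mult_left_mono) auto
      also have "\<dots> < (\<bar>C\<bar> + 1) * (2 * h)" using \<open>0 < h\<close> by (intro mult_strict_right_mono) auto
      also have "\<dots> \<le> (\<bar>C\<bar> + 1) * (2 * (e / (2 * (\<bar>C\<bar> + 1))))"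
        by (intro mult_left_mono) (auto simp: h_def)
      also have "\<dots> = e"
      proof -
        have "\<bar>C\<bar> + 1 \<noteq> 0" by linarith
        then show ?thesis by (simp add: field_simps)
      qed
      finally show ?thesis by (simp add: dist_real_def)
    qed
    then show "\<exists>N. \<forall>m\<ge>N. \<forall>n\<ge>N. dist (U (rat_below m t) x) (U (rat_below n t) x) < e" by blast
  qed
  then show ?thesis
    unfolding ext_def using real_Cauchy_convergent convergent_LIMSEQ_iff by blast
qed

lemma ext_locally_Lipschitz:
  assumes "0 \<le> t"
  obtains d C where "0 < d" "\<And>r x. 0 \<le> r \<Longrightarrow> \<bar>r - t\<bar> < d \<Longrightarrow> \<bar>ext r x\<bar> \<le> C"
    "\<And>r s x. 0 \<le> r \<Longrightarrow> 0 \<le> s \<Longrightarrow> \<bar>r - t\<bar> < d \<Longrightarrow> \<bar>s - t\<bar> < d \<Longrightarrow> \<bar>ext s x - ext r x\<bar> \<le> C * \<bar>s - r\<bar>"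
proof -
  obtain d C where d: "0 < d"
    "\<And>r x. r \<in> \<rat> \<inter> {0..} \<Longrightarrow> \<bar>r - t\<bar> < d \<Longrightarrow> \<bar>U r x\<bar> \<le> C"
    "\<And>r s x. r \<in> \<rat> \<inter> {0..} \<Longrightarrow> s \<in> \<rat> \<inter> {0..} \<Longrightarrow> \<bar>r - t\<bar> < d \<Longrightarrow> \<bar>s - t\<bar> < d \<Longrightarrow>
      \<bar>U s x - U r x\<bar> \<le> C * \<bar>s - r\<bar>"
    using locally_Lipschitz_rational[OF assms] by metis
  show ?thesis
  proof (rule that[OF d(1)])
    fix r x assume r: "0 \<le> r" "\<bar>r - t\<bar> < d"
    show "\<bar>ext r x\<bar> \<le> C"
    proof (rule tendsto_upperbound)
      show "(\<lambda>n. \<bar>U (rat_below n r) x\<bar>) \<longlonglongrightarrow> \<bar>ext r x\<bar>" by (intro tendsto_rabs ext_tendsto r)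
      show "\<forall>\<^sub>F n in sequentially. \<bar>U (rat_below n r) x\<bar> \<le> C"
        using rat_below_near[OF r(2)] by eventually_elim (rule d(2)[OF rat_below_in[OF r(1)]])
    qed simp
  next
    fix r s x assume rs: "0 \<le> r" "0 \<le> s" "\<bar>r - t\<bar> < d" "\<bar>s - t\<bar> < d"
    show "\<bar>ext s x - ext r x\<bar> \<le> C * \<bar>s - r\<bar>"
    proof (rule tendsto_le)
      show "(\<lambda>n. \<bar>U (rat_below n s) x - U (rat_below n r) x\<bar>) \<longlonglongrightarrow> \<bar>ext s x - ext r x\<bar>"
        by (intro tendsto_intros ext_tendsto rs)
      show "(\<lambda>n. C * \<bar>rat_below n s - rat_below n r\<bar>) \<longlonglongrightarrow> C * \<bar>s - r\<bar>"
        by (intro tendsto_intros rat_below_tendsto)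
      show "\<forall>\<^sub>F n in sequentially. \<bar>U (rat_below n s) x - U (rat_below n r) x\<bar> \<le> C * \<bar>rat_below n s - rat_below n r\<bar>"
        using rat_below_near[OF rs(3)] rat_below_near[OF rs(4)]
        by eventually_elim (rule d(3)[OF rat_below_in[OF rs(1)] rat_below_in[OF rs(2)]])
    qed simp
  qed
qed

lemma ext_continuous: "continuous_on {0..} (\<lambda>t. ext t x)"
  unfolding continuous_on_iff
proof (intro ballI allI impI)
  fix t e :: real assume "t \<in> {0..}" "0 < e"
  then obtain d C where d: "0 < d"
    "\<And>r s x. 0 \<le> r \<Longrightarrow> 0 \<le> s \<Longrightarrow> \<bar>r - t\<bar> < d \<Longrightarrow> \<bar>s - t\<bar> < d \<Longrightarrow> \<bar>ext s x - ext r x\<bar> \<le> C * \<bar>s - r\<bar>"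
    using ext_locally_Lipschitz[of t] by (metis atLeast_iff)
  show "\<exists>h>0. \<forall>s\<in>{0..}. dist s t < h \<longrightarrow> dist (ext s x) (ext t x) < e"
  proof (intro exI[of _ "min d (e / (\<bar>C\<bar> + 1))"] conjI ballI impI)
    show "0 < min d (e / (\<bar>C\<bar> + 1))" using d(1) \<open>0 < e\<close> by simp
    fix s :: real assume s: "s \<in> {0..}" "dist s t < min d (e / (\<bar>C\<bar> + 1))"
    then have "\<bar>ext s x - ext t x\<bar> \<le> C * \<bar>s - t\<bar>"
      using d(2)[of t s x] \<open>t \<in> {0..}\<close> d(1) by (simp add: dist_real_def)
    also have "\<dots> \<le> (\<bar>C\<bar> + 1) * \<bar>s - t\<bar>" by (intro mult_right_mono) auto
    also have "\<dots> < (\<bar>C\<bar> + 1) * (e / (\<bar>C\<bar> + 1))"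
      using s(2) by (intro mult_strict_left_mono) (auto simp: dist_real_def)
    also have "\<dots> = e"
    proof -
      have "\<bar>C\<bar> + 1 \<noteq> 0" by linarith
      then show ?thesis by simp
    qed
    finally show "dist (ext s x) (ext t x) < e" by (simp add: dist_real_def)
  qed
qed

lemma ext_bounded: "\<exists>C. \<forall>t\<in>{0..T}. \<forall>x. \<bar>ext t x\<bar> \<le> C"
proof (cases "0 \<le> T")
  case True
  \<comment> \<open>The clause \<open>0 \<le> t\<close> is there because the bisection principle
    also tests small intervals that begin to the left of 0.\<close>
  define P where "P a b \<longleftrightarrow> (\<exists>C. \<forall>t\<in>{a..b}. 0 \<le> t \<longrightarrow> (\<forall>x. \<bar>ext t x\<bar> \<le> C))" for a b :: real
  have "P 0 T"
  proof (rule Bolzano[OF True])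
    fix a b c assume "P a b" "P b c" "a \<le> b" "b \<le> c"
    then obtain C1 C2 where C: "\<forall>t\<in>{a..b}. 0 \<le> t \<longrightarrow> (\<forall>x. \<bar>ext t x\<bar> \<le> C1)"
      "\<forall>t\<in>{b..c}. 0 \<le> t \<longrightarrow> (\<forall>x. \<bar>ext t x\<bar> \<le> C2)" unfolding P_def by blast
    have "\<bar>ext t x\<bar> \<le> max C1 C2" if "t \<in> {a..c}" "0 \<le> t" for t x
      using C(1)[rule_format, of t x] C(2)[rule_format, of t x] that by (cases "t \<le> b") auto
    then show "P a c" unfolding P_def by blast
  next
    fix t assume t: "0 \<le> t" "t \<le> T"
    obtain d C where d: "0 < d" "\<And>r x. 0 \<le> r \<Longrightarrow> \<bar>r - t\<bar> < d \<Longrightarrow> \<bar>ext r x\<bar> \<le> C"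
      using ext_locally_Lipschitz[OF t(1)] by metis
    then show "\<exists>d>0. \<forall>a b. a \<le> t \<and> t \<le> b \<and> b - a < d \<longrightarrow> P a b"
      unfolding P_def by (intro exI[of _ d] conjI allI impI exI[of _ C] ballI) auto
  qed
  then show ?thesis unfolding P_def by auto
qed auto

text \<open>The base point \<open>rat_below n t\<close> moves with \<open>n\<close>. Since
  \<open>strict\<close> is uniform in both times near \<open>t\<close>, its estimate survives the
  limit in both of them at once, and convergence of \<open>V\<close> along this one sequence
  suffices.\<close>

lemma ext_has_derivative:
  assumes "0 < t" and l: "(\<lambda>n. V (rat_below n t) x) \<longlonglongrightarrow> l"
  shows "((\<lambda>t. ext t x) has_real_derivative l) (at t)"
  unfolding has_field_derivative_iff
proof (rule tendstoI)
  fix e :: real assume "0 < e"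
  then obtain d where d: "0 < d" "\<forall>r\<in>\<rat> \<inter> {0..}. \<forall>s\<in>\<rat> \<inter> {0..}.
      \<bar>r - t\<bar> < d \<longrightarrow> \<bar>s - t\<bar> < d \<longrightarrow> (\<forall>x. \<bar>U s x - U r x - (s - r) * V r x\<bar> \<le> e / 2 * \<bar>s - r\<bar>)"
    using strict[of t "e / 2"] assms(1) by (metis half_gt_zero less_imp_le)
  have "dist ((ext s x - ext t x) / (s - t)) l < e" if s: "s \<noteq> t" "\<bar>s - t\<bar> < min d t" for s
  proof -
    have t0: "0 \<le> t" "0 \<le> s" using s assms(1) by auto
    have "\<bar>ext s x - ext t x - (s - t) * l\<bar> \<le> e / 2 * \<bar>s - t\<bar>"
    proof (rule tendsto_le)
      show "(\<lambda>n. \<bar>U (rat_below n s) x - U (rat_below n t) x - (rat_below n s - rat_below n t) * V (rat_below n t) x\<bar>)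
          \<longlonglongrightarrow> \<bar>ext s x - ext t x - (s - t) * l\<bar>"
        by (intro tendsto_intros ext_tendsto t0 rat_below_tendsto l)
      show "(\<lambda>n. e / 2 * \<bar>rat_below n s - rat_below n t\<bar>) \<longlonglongrightarrow> e / 2 * \<bar>s - t\<bar>"
        by (intro tendsto_intros rat_below_tendsto)
      have "\<forall>\<^sub>F n in sequentially. \<bar>rat_below n s - t\<bar> < d" "\<forall>\<^sub>F n in sequentially. \<bar>rat_below n t - t\<bar> < d"
        using s d(1) by (auto intro!: rat_below_near)
      then show "\<forall>\<^sub>F n in sequentially. \<bar>U (rat_below n s) x - U (rat_below n t) x - (rat_below n s - rat_below n t) * V (rat_below n t) x\<bar>
          \<le> e / 2 * \<bar>rat_below n s - rat_below n t\<bar>"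
        by eventually_elim (use d(2) rat_below_in[OF t0(1)] rat_below_in[OF t0(2)] in blast)
    qed simp
    moreover have "(ext s x - ext t x) / (s - t) - l = (ext s x - ext t x - (s - t) * l) / (s - t)"
      using s by (simp add: field_simps)
    ultimately have "\<bar>(ext s x - ext t x) / (s - t) - l\<bar> \<le> e / 2"
      using s by (simp add: abs_divide pos_divide_le_eq)
    then show ?thesis using \<open>0 < e\<close> by (simp add: dist_real_def)
  qed
  then show "\<forall>\<^sub>F s in at t. dist ((ext s x - ext t x) / (s - t)) l < e"
    unfolding eventually_at using d(1) assms(1)
    by (intro exI[of _ "min d t"]) (auto simp: dist_real_def)
qed

end

section \<open>Construction of the pathwise version\<close>

context finite_measure
begin

text \<open>Only countably many conditions at rational times have to be met for a path to be
  recovered. Points violating one of them form a null set, on which the path of one fixed good point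
  is used instead; thus all pointwise conclusions, and the property \<open>P\<close> of the initial
  value, hold at every \<open>x\<close>.\<close>

lemma Linf_solution_pathwise:
  fixes u v :: "real \<Rightarrow> 'a \<Rightarrow> real" and f :: "real \<Rightarrow> real" and c :: real
  assumes nonnull: "emeasure M (space M) \<noteq> 0"
    and f: "continuous_on UNIV f"
    and u: "\<And>t. 0 \<le> t \<Longrightarrow> u t \<in> Linf M"
    and v: "\<And>t. 0 \<le> t \<Longrightarrow> v t \<in> Linf M"
    and deriv: "\<And>t. 0 \<le> t \<Longrightarrow> Linf_has_deriv M u (v t) t"
    and cont: "\<And>t. 0 \<le> t \<Longrightarrow> Linf_tendsto M v (v t) (at t within {0..})"
    and ode: "\<And>t. 0 < t \<Longrightarrow> AE x in M. v t x = f (u t x) - c * (LINT y|M. f (u t y))"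
    and init: "AE x in M. P (u 0 x)"
  obtains w :: "real \<Rightarrow> 'a \<Rightarrow> real" where
    "\<And>t. 0 \<le> t \<Longrightarrow> w t \<in> borel_measurable M"
    "\<And>t. 0 \<le> t \<Longrightarrow> AE x in M. w t x = u t x"
    "\<And>x t. 0 < t \<Longrightarrow> ((\<lambda>t. w t x) has_real_derivative f (w t x) - c * (LINT y|M. f (w t y))) (at t)"
    "\<And>x. continuous_on {0..} (\<lambda>t. w t x)"
    "\<And>T. \<exists>C. \<forall>t\<in>{0..T}. \<forall>x. \<bar>w t x\<bar> \<le> C"
    "\<And>x. P (w 0 x)"
proof -
  let ?Q = "\<rat> \<inter> {0..} :: real set"
  define lam where "lam t = c * (LINT y|M. f (u t y))" for t
  have cQ: "countable ?Q" "countable (\<rat> :: real set)" using countable_rat by auto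
  have u_meas: "u t \<in> borel_measurable M" if "0 \<le> t" for t
    using u[OF that] by (simp add: Linf_def)
  have f_meas: "f \<in> borel_measurable borel" by (rule borel_measurable_continuous_onI[OF f])

  \<comment> \<open>Each bound is imposed in the form "if it holds almost everywhere, then it holds
    here", so the valid constants need not be known in advance. Restricting the constants
    \<open>e\<close> to rationals keeps the family countable.\<close>
  define good where "good x \<longleftrightarrow>
      (\<forall>r\<in>?Q. \<forall>s\<in>?Q. \<forall>e\<in>\<rat>. (AE y in M. \<bar>u s y - u r y - (s - r) * v r y\<bar> \<le> e * \<bar>s - r\<bar>)
        \<longrightarrow> \<bar>u s x - u r x - (s - r) * v r x\<bar> \<le> e * \<bar>s - r\<bar>) \<and>
      (\<forall>r\<in>?Q. \<forall>e\<in>\<rat>. (AE y in M. \<bar>u r y\<bar> \<le> e) \<longrightarrow> \<bar>u r x\<bar> \<le> e) \<and>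
      (\<forall>r\<in>?Q. \<forall>e\<in>\<rat>. (AE y in M. \<bar>v r y\<bar> \<le> e) \<longrightarrow> \<bar>v r x\<bar> \<le> e) \<and>
      (\<forall>r\<in>?Q. 0 < r \<longrightarrow> v r x = f (u r x) - lam r) \<and> P (u 0 x)" for x
  have "AE x in M. \<forall>r\<in>?Q. \<forall>s\<in>?Q. \<forall>e\<in>\<rat>. (AE y in M. \<bar>u s y - u r y - (s - r) * v r y\<bar> \<le> e * \<bar>s - r\<bar>)
        \<longrightarrow> \<bar>u s x - u r x - (s - r) * v r x\<bar> \<le> e * \<bar>s - r\<bar>"
    by (simp only: AE_ball_countable[OF cQ(1)] AE_ball_countable[OF cQ(2)]) auto
  moreover have "AE x in M. \<forall>r\<in>?Q. \<forall>e\<in>\<rat>. (AE y in M. \<bar>u r y\<bar> \<le> e) \<longrightarrow> \<bar>u r x\<bar> \<le> e"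
    by (simp only: AE_ball_countable[OF cQ(1)] AE_ball_countable[OF cQ(2)]) auto
  moreover have "AE x in M. \<forall>r\<in>?Q. \<forall>e\<in>\<rat>. (AE y in M. \<bar>v r y\<bar> \<le> e) \<longrightarrow> \<bar>v r x\<bar> \<le> e"
    by (simp only: AE_ball_countable[OF cQ(1)] AE_ball_countable[OF cQ(2)]) auto
  moreover have "AE x in M. \<forall>r\<in>?Q. 0 < r \<longrightarrow> v r x = f (u r x) - lam r"
    unfolding AE_ball_countable[OF cQ(1)] using ode by (auto simp: lam_def)
  ultimately have "AE x in M. good x"
    using init unfolding good_def by eventually_elim blast
  then obtain N where N: "{x \<in> space M. \<not> good x} \<subseteq> N" "emeasure M N = 0" "N \<in> sets M"
    by (rule AE_E)
  have "space M \<noteq> N" using nonnull N(2) by auto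
  then obtain x0 where x0: "x0 \<in> space M" "x0 \<notin> N" using sets.sets_into_space[OF N(3)] by auto
  \<comment> \<open>\<open>\<rho>\<close> redirects all exceptional points to the good point
    \<open>x0\<close>, which exists because the measure is not zero.\<close>
  define \<rho> where "\<rho> x = (if x \<in> space M - N then x else x0)" for x
  have good: "good (\<rho> x)" and \<rho>_space: "\<rho> x \<in> space M" for x
    using N(1) x0 by (auto simp: \<rho>_def)
  have \<rho>_meas: "\<rho> \<in> measurable M M"
    unfolding \<rho>_def by (rule measurable_If_set) (use N(3) x0 in auto)
  have \<rho>_AE: "AE x in M. \<rho> x = x"
    using AE_not_in[of N M] N by (auto simp: \<rho>_def null_sets_def)

  have Linf_near: "\<exists>d>0. \<exists>C\<in>\<rat>. \<forall>r\<ge>0. \<bar>r - t\<bar> < d \<longrightarrow> (AE x in M. \<bar>u r x\<bar> \<le> C) \<and> (AE x in M. \<bar>v r x\<bar> \<le> C) \<and>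
      (AE x in M. \<bar>u r x - u t x\<bar> \<le> C * \<bar>r - t\<bar>)" if t: "0 \<le> t" for t
  proof -
    obtain C1 where C1: "AE x in M. \<bar>u t x\<bar> \<le> C1" using Linf_AE_bounded[OF u[OF t]] .
    obtain C2 where C2: "AE x in M. \<bar>v t x\<bar> \<le> C2" using Linf_AE_bounded[OF v[OF t]] .
    obtain d1 where d1: "0 < d1" "\<And>r. 0 \<le> r \<Longrightarrow> \<bar>r - t\<bar> < d1 \<Longrightarrow> r \<noteq> t \<Longrightarrow> AE x in M. \<bar>v r x - v t x\<bar> \<le> 1"
      using Linf_tendsto_AE[OF cont[OF t], of 1] unfolding eventually_at by (auto simp: dist_real_def)
    obtain d2 where d2: "0 < d2" "\<forall>r\<ge>0. \<forall>s\<ge>0. \<bar>r - t\<bar> < d2 \<longrightarrow> \<bar>s - t\<bar> < d2 \<longrightarrow>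
        (AE x in M. \<bar>u s x - u r x - (s - r) * v r x\<bar> \<le> 1 * \<bar>s - r\<bar>)"
      using Linf_C1_strict_derivative[OF u v deriv cont t zero_less_one] by blast
    \<comment> \<open>\<open>C\<close> is taken rational so that \<open>good\<close> applies to it;
      it exceeds the bounds at time \<open>t\<close> plus the growth over a time step of length at
      most 1.\<close>
    obtain C where C: "C \<in> \<rat>" "\<bar>C1\<bar> + \<bar>C2\<bar> + 1 < C"
      using Rats_dense_in_real[of "\<bar>C1\<bar> + \<bar>C2\<bar> + 1" "\<bar>C1\<bar> + \<bar>C2\<bar> + 2"] by auto
    show ?thesis
    proof (intro exI[of _ "min 1 (min d1 d2)"] conjI bexI[of _ C] allI impI C)
      show "0 < min 1 (min d1 d2)" using d1 d2 by simp
    next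
      fix r assume r: "0 \<le> r" "\<bar>r - t\<bar> < min 1 (min d1 d2)"
      have v1: "AE x in M. \<bar>v r x - v t x\<bar> \<le> 1" using d1(2)[of r] r by (cases "r = t") auto
      have u1: "AE x in M. \<bar>u r x - u t x - (r - t) * v t x\<bar> \<le> \<bar>r - t\<bar>"
        using d2(2)[rule_format, of t r] r t d2(1) by simp
      have u2: "AE x in M. \<bar>u r x - u t x\<bar> \<le> (\<bar>C2\<bar> + 1) * \<bar>r - t\<bar>"
        using u1 C2
      proof eventually_elim
        case (elim x)
        have "\<bar>(r - t) * v t x\<bar> \<le> \<bar>C2\<bar> * \<bar>r - t\<bar>"
          using elim(2) mult_left_mono[of "\<bar>v t x\<bar>" "\<bar>C2\<bar>" "\<bar>r - t\<bar>"] by (simp add: abs_mult mult.commute)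
        then show ?case using elim(1) by (simp add: distrib_right)
      qed
      have r1: "(\<bar>C2\<bar> + 1) * \<bar>r - t\<bar> \<le> \<bar>C2\<bar> + 1"
        using r mult_left_le[of "\<bar>r - t\<bar>" "\<bar>C2\<bar> + 1"] by simp
      have r2: "(\<bar>C2\<bar> + 1) * \<bar>r - t\<bar> \<le> C * \<bar>r - t\<bar>"
        using C(2) by (intro mult_right_mono) auto
      show "AE x in M. \<bar>v r x\<bar> \<le> C" using v1 C2 by eventually_elim (use C(2) in linarith)
      show "AE x in M. \<bar>u r x\<bar> \<le> C" using u2 C1 by eventually_elim (use C(2) r1 in linarith)
      show "AE x in M. \<bar>u r x - u t x\<bar> \<le> C * \<bar>r - t\<bar>" using u2 by eventually_elim (use r2 in linarith)
    qed
  qed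

  interpret rational_curves "\<lambda>r x. u r (\<rho> x)" "\<lambda>r x. v r (\<rho> x)"
  proof
    fix t :: real assume t: "0 \<le> t"
    show "\<exists>d>0. \<exists>C. \<forall>r\<in>?Q. \<bar>r - t\<bar> < d \<longrightarrow> (\<forall>x. \<bar>u r (\<rho> x)\<bar> \<le> C \<and> \<bar>v r (\<rho> x)\<bar> \<le> C)"
    proof -
      obtain d C where "d > 0" "C \<in> \<rat>" and dC: "\<forall>r\<ge>0. \<bar>r - t\<bar> < d \<longrightarrow> (AE x in M. \<bar>u r x\<bar> \<le> C) \<and> (AE x in M. \<bar>v r x\<bar> \<le> C) \<and>
          (AE x in M. \<bar>u r x - u t x\<bar> \<le> C * \<bar>r - t\<bar>)"
        using Linf_near[OF t] by blast
      have "\<bar>u r (\<rho> x)\<bar> \<le> C \<and> \<bar>v r (\<rho> x)\<bar> \<le> C" if r: "r \<in> ?Q" "\<bar>r - t\<bar> < d" for r x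
      proof -
        have "AE x in M. \<bar>u r x\<bar> \<le> C" "AE x in M. \<bar>v r x\<bar> \<le> C" using dC r by auto
        then show ?thesis using good[of x] r(1) \<open>C \<in> \<rat>\<close> unfolding good_def by blast
      qed
      then show ?thesis using \<open>d > 0\<close> by blast
    qed
    fix e :: real assume "0 < e"
    \<comment> \<open>A rational error below \<open>e\<close> is needed, since \<open>good\<close>
      speaks of rational constants only.\<close>
    then obtain e' where e': "e' \<in> \<rat>" "0 < e'" "e' < e" using Rats_dense_in_real[of 0 e] by auto
    obtain d where d: "0 < d" "\<forall>r\<ge>0. \<forall>s\<ge>0. \<bar>r - t\<bar> < d \<longrightarrow> \<bar>s - t\<bar> < d \<longrightarrow>
        (AE x in M. \<bar>u s x - u r x - (s - r) * v r x\<bar> \<le> e' * \<bar>s - r\<bar>)"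
      using Linf_C1_strict_derivative[OF u v deriv cont t e'(2)] by blast
    show "\<exists>d>0. \<forall>r\<in>?Q. \<forall>s\<in>?Q. \<bar>r - t\<bar> < d \<longrightarrow> \<bar>s - t\<bar> < d \<longrightarrow>
        (\<forall>x. \<bar>u s (\<rho> x) - u r (\<rho> x) - (s - r) * v r (\<rho> x)\<bar> \<le> e * \<bar>s - r\<bar>)"
    proof (intro exI[of _ d] conjI ballI impI allI d(1))
      fix r s x assume rs: "r \<in> ?Q" "s \<in> ?Q" "\<bar>r - t\<bar> < d" "\<bar>s - t\<bar> < d"
      then have "AE x in M. \<bar>u s x - u r x - (s - r) * v r x\<bar> \<le> e' * \<bar>s - r\<bar>" using d(2) by auto
      then have "\<bar>u s (\<rho> x) - u r (\<rho> x) - (s - r) * v r (\<rho> x)\<bar> \<le> e' * \<bar>s - r\<bar>"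
        using good[of x] rs e'(1) unfolding good_def by blast
      also have "\<dots> \<le> e * \<bar>s - r\<bar>" using e' by (intro mult_right_mono) auto
      finally show "\<bar>u s (\<rho> x) - u r (\<rho> x) - (s - r) * v r (\<rho> x)\<bar> \<le> e * \<bar>s - r\<bar>" .
    qed
  qed

  have ext_meas: "ext t \<in> borel_measurable M" if t: "0 \<le> t" for t
  proof (rule borel_measurable_LIMSEQ_real[OF ext_tendsto[OF t]])
    show "(\<lambda>x. u (rat_below i t) (\<rho> x)) \<in> borel_measurable M" for i
      using measurable_compose[OF \<rho>_meas u_meas] rat_below_in[OF t, of i] by auto
  qed

  have u_conv: "AE x in M. (\<lambda>n. u (rat_below n t) x) \<longlonglongrightarrow> u t x" if t: "0 \<le> t" for t
  proof -
    obtain d C where d: "d > 0" "\<forall>r\<ge>0. \<bar>r - t\<bar> < d \<longrightarrow> (AE x in M. \<bar>u r x - u t x\<bar> \<le> C * \<bar>r - t\<bar>)"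
      using Linf_near[OF t] by blast
    have "AE x in M. \<forall>n. \<bar>rat_below n t - t\<bar> < d \<longrightarrow> \<bar>u (rat_below n t) x - u t x\<bar> \<le> C * \<bar>rat_below n t - t\<bar>"
      unfolding AE_all_countable using d(2) rat_below_in[OF t] by auto
    then show ?thesis
    proof eventually_elim
      case (elim x)
      have "(\<lambda>n. C * \<bar>rat_below n t - t\<bar>) \<longlonglongrightarrow> C * \<bar>t - t\<bar>" by (intro tendsto_intros rat_below_tendsto)
      then have lim0: "(\<lambda>n. C * \<bar>rat_below n t - t\<bar>) \<longlonglongrightarrow> 0" by simp
      have "\<forall>\<^sub>F n in sequentially. \<bar>rat_below n t - t\<bar> < d" using d(1) by (intro rat_below_near) simp
      then have "\<forall>\<^sub>F n in sequentially. norm (u (rat_below n t) x - u t x) \<le> C * \<bar>rat_below n t - t\<bar>"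
        by eventually_elim (use elim in simp)
      then have "(\<lambda>n. u (rat_below n t) x - u t x) \<longlonglongrightarrow> 0" using lim0 by (rule Lim_null_comparison)
      then show ?case by (rule LIM_zero_cancel)
    qed
  qed

  have ext_AE: "AE x in M. ext t x = u t x" if t: "0 \<le> t" for t
    using u_conv[OF t] \<rho>_AE
  proof eventually_elim
    case (elim x)
    then show ?case using ext_tendsto[OF t, of x] by (intro LIMSEQ_unique[of "\<lambda>n. u (rat_below n t) x"]) auto
  qed

  have lam_conv: "(\<lambda>n. lam (rat_below n t)) \<longlonglongrightarrow> lam t" if t: "0 \<le> t" for t
  proof -
    obtain d C where d: "d > 0" "\<forall>r\<ge>0. \<bar>r - t\<bar> < d \<longrightarrow> (AE x in M. \<bar>u r x\<bar> \<le> C)"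
      using Linf_near[OF t] by blast
    have "bounded (f ` {-C..C})"
      by (intro compact_imp_bounded compact_continuous_image continuous_on_subset[OF f]) auto
    then obtain B where B: "\<forall>s\<in>{-C..C}. \<bar>f s\<bar> \<le> B" unfolding bounded_iff by auto
    \<comment> \<open>The bound \<open>C\<close> is available only for times within \<open>d\<close>
      of \<open>t\<close>, so dominated convergence is applied to the sequence from index
      \<open>k\<close> on.\<close>
    obtain k where k: "\<And>n. n \<ge> k \<Longrightarrow> \<bar>rat_below n t - t\<bar> < d"
      using rat_below_near[of t t d] d(1) by (auto simp: eventually_sequentially)
    have "(\<lambda>n. LINT y|M. f (u (rat_below (n + k) t) y)) \<longlonglongrightarrow> (LINT y|M. f (u t y))"
    proof (rule integral_dominated_convergence[where w = "\<lambda>_. B"])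
      show "(\<lambda>y. f (u t y)) \<in> borel_measurable M"
        by (rule measurable_compose[OF u_meas[OF t] f_meas])
      show "(\<lambda>y. f (u (rat_below (n + k) t) y)) \<in> borel_measurable M" for n
        by (rule measurable_compose[OF u_meas f_meas]) (use rat_below_in[OF t] in auto)
      show "AE y in M. (\<lambda>n. f (u (rat_below (n + k) t) y)) \<longlonglongrightarrow> f (u t y)"
        using u_conv[OF t]
      proof eventually_elim
        case (elim y)
        then have "(\<lambda>n. f (u (rat_below n t) y)) \<longlonglongrightarrow> f (u t y)"
          using continuous_on_tendsto_compose[OF f] by simp
        then show ?case by (rule LIMSEQ_ignore_initial_segment)
      qed
      show "AE y in M. norm (f (u (rat_below (n + k) t) y)) \<le> B" for n
      proof -
        have "AE y in M. \<bar>u (rat_below (n + k) t) y\<bar> \<le> C" using d(2) k[of "n + k"] rat_below_in[OF t] by auto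
        then show ?thesis
        proof eventually_elim
          case (elim y)
          then have "u (rat_below (n + k) t) y \<in> {-C..C}" by (simp add: abs_le_iff minus_le_iff)
          then show ?case using B by simp
        qed
      qed
    qed simp
    then have "(\<lambda>n. LINT y|M. f (u (rat_below n t) y)) \<longlonglongrightarrow> (LINT y|M. f (u t y))"
      by (rule LIMSEQ_offset)
    then show ?thesis unfolding lam_def by (intro tendsto_intros)
  qed

  have lam_ext: "lam t = c * (LINT y|M. f (ext t y))" if t: "0 \<le> t" for t
  proof -
    have "AE y in M. f (u t y) = f (ext t y)" using ext_AE[OF t] by eventually_elim simp
    then show ?thesis unfolding lam_def
      using integral_cong_AE measurable_compose[OF u_meas[OF t] f_meas] measurable_compose[OF ext_meas[OF t] f_meas]
      by metis
  qed

  show ?thesis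
  proof (rule that[of ext])
    fix x and t :: real assume t: "0 < t"
    show "((\<lambda>t. ext t x) has_real_derivative f (ext t x) - c * (LINT y|M. f (ext t y))) (at t)"
    proof (rule ext_has_derivative[OF t])
      have "(\<lambda>n. f (u (rat_below n t) (\<rho> x)) - lam (rat_below n t)) \<longlonglongrightarrow> f (ext t x) - lam t"
        using continuous_on_tendsto_compose[OF f ext_tendsto] lam_conv t by (intro tendsto_intros) auto
      \<comment> \<open>The equation is given at positive times only; since \<open>t > 0\<close>,
        the approximating times are eventually positive.\<close>
      moreover have "\<forall>\<^sub>F n in sequentially. f (u (rat_below n t) (\<rho> x)) - lam (rat_below n t) = v (rat_below n t) (\<rho> x)"
        using rat_below_near[of t t t]
      proof (rule eventually_mono)
        show "\<bar>t - t\<bar> < t" using t by simp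
        fix n assume "\<bar>rat_below n t - t\<bar> < t"
        then have "0 < rat_below n t" by linarith
        then show "f (u (rat_below n t) (\<rho> x)) - lam (rat_below n t) = v (rat_below n t) (\<rho> x)"
          using good[of x] rat_below_in[of t n] t unfolding good_def by simp
      qed
      ultimately show "(\<lambda>n. v (rat_below n t) (\<rho> x)) \<longlonglongrightarrow> f (ext t x) - c * (LINT y|M. f (ext t y))"
        using Lim_transform_eventually lam_ext t by fastforce
    qed
  next
    fix x
    have "rat_below n 0 = 0" for n by (simp add: rat_below_def)
    then have "ext 0 x = u 0 (\<rho> x)" using ext_tendsto[of 0 x] by (simp add: LIMSEQ_const_iff)
    then show "P (ext 0 x)" using good[of x] by (simp add: good_def)
  qed (use ext_meas ext_AE ext_continuous ext_bounded in auto)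
qed

end

section \<open>Invariance of the strip\<close>

lemma Lipschitz_from_derivative_bound:
  fixes y y' :: "real \<Rightarrow> real"
  assumes cont: "continuous_on {0..} y"
    and deriv: "\<And>t. 0 < t \<Longrightarrow> (y has_real_derivative y' t) (at t)"
    and bound: "\<And>t. 0 < t \<Longrightarrow> \<bar>y' t\<bar> \<le> K"
    and st: "0 \<le> s" "0 \<le> t"
  shows "\<bar>y s - y t\<bar> \<le> K * \<bar>s - t\<bar>"
proof -
  have less: "\<bar>y b - y a\<bar> \<le> K * \<bar>b - a\<bar>" if ab: "0 \<le> a" "a < b" for a b
  proof -
    have c: "continuous_on {a..b} y" using cont by (rule continuous_on_subset) (use ab in auto)
    have diff: "y differentiable (at r)" if "a < r" "r < b" for r
      unfolding real_differentiable_def using deriv[of r] that ab by auto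
    obtain l r where r: "a < r" "r < b" "(y has_real_derivative l) (at r)" "y b - y a = (b - a) * l"
      using MVT[OF ab(2) c diff] by blast
    have "0 < r" using r(1) ab by simp
    then have "l = y' r" using DERIV_unique[OF r(3) deriv] by blast
    then have "\<bar>l\<bar> \<le> K" using bound[OF \<open>0 < r\<close>] by simp
    then have "\<bar>b - a\<bar> * \<bar>l\<bar> \<le> \<bar>b - a\<bar> * K" by (rule mult_left_mono) simp
    then show ?thesis using r(4) by (simp add: abs_mult mult.commute)
  qed
  show ?thesis
    using less[of s t] less[of t s] st by (cases s t rule: linorder_cases) (auto simp: abs_minus_commute)
qed

section \<open>Averages and the lower barrier\<close>

context finite_measure
begin

definition mean :: "('a \<Rightarrow> real) \<Rightarrow> real" where
  "mean g = 1 / measure M (space M) * (LINT x|M. g x)"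

lemma integrable_bounded_comp:
  fixes g :: "'a \<Rightarrow> real" and h :: "real \<Rightarrow> real"
  assumes "g \<in> borel_measurable M" "continuous_on UNIV h" "\<And>x. g x \<in> {a..b}"
  shows "integrable M (\<lambda>x. h (g x))"
proof -
  have "bounded (h ` {a..b})"
    by (intro compact_imp_bounded compact_continuous_image continuous_on_subset[OF assms(2)]) auto
  then obtain B where "\<forall>s\<in>{a..b}. \<bar>h s\<bar> \<le> B" unfolding bounded_iff by auto
  then have "AE x in M. norm (h (g x)) \<le> B" using assms(3) by auto
  moreover have "(\<lambda>x. h (g x)) \<in> borel_measurable M"
    by (rule measurable_compose[OF assms(1) borel_measurable_continuous_onI[OF assms(2)]])
  ultimately show ?thesis by (rule integrable_const_bound)
qed

lemma mean_le:
  assumes "0 < measure M (space M)" "integrable M g" "\<And>x. g x \<le> b"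
  shows "mean g \<le> b"
proof -
  have "(LINT x|M. g x) \<le> (LINT x|M. b)" by (rule integral_mono) (use assms in auto)
  then show ?thesis unfolding mean_def using assms(1) by (simp add: pos_divide_le_eq mult.commute)
qed

lemma mean_ge:
  assumes "0 < measure M (space M)" "integrable M g" "\<And>x. b \<le> g x"
  shows "b \<le> mean g"
proof -
  have "(LINT x|M. b) \<le> (LINT x|M. g x)" by (rule integral_mono) (use assms in auto)
  then show ?thesis unfolding mean_def using assms(1) by (simp add: pos_le_divide_eq mult.commute)
qed

lemma mean_diff: "integrable M g \<Longrightarrow> integrable M h \<Longrightarrow> mean (\<lambda>x. g x - h x) = mean g - mean h"
  unfolding mean_def by (simp add: right_diff_distrib diff_divide_distrib)

lemma mean_uminus: "mean (\<lambda>x. - g x) = - mean g"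
  unfolding mean_def by simp

text \<open>If \<open>s\<^sub>1 - w \<le> D e\<^sup>K\<^sup>t\<close> then the mean of \<open>f(w)\<close> exceeds \<open>f(s\<^sub>1)\<close> by at most \<open>L D e\<^sup>K\<^sup>t\<close>, and the
  differential equation improves the constant \<open>D\<close> to \<open>D/2\<close>.\<close>

lemma lower_barrier:
  fixes f f' :: "real \<Rightarrow> real" and w :: "real \<Rightarrow> 'a \<Rightarrow> real"
  assumes nonnull: "0 < measure M (space M)"
    and f_deriv: "\<And>s. (f has_real_derivative f' s) (at s)" and f'_cont: "continuous_on UNIV f'"
    and f_le: "\<And>s. s1 \<le> s \<Longrightarrow> f s \<le> f s1"
    and w_meas: "\<And>t. 0 \<le> t \<Longrightarrow> w t \<in> borel_measurable M"
    and ode: "\<And>x t. 0 < t \<Longrightarrow> ((\<lambda>t. w t x) has_real_derivative f (w t x) - mean (\<lambda>y. f (w t y))) (at t)"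
    and cont: "\<And>x. continuous_on {0..} (\<lambda>t. w t x)"
    and bdd: "\<And>T. \<exists>C. \<forall>t\<in>{0..T}. \<forall>x. \<bar>w t x\<bar> \<le> C"
    and init: "\<And>x. s1 \<le> w 0 x"
    and "0 \<le> T"
  shows "s1 \<le> w T x"
proof -
  have f_cont: "continuous_on UNIV f"
    by (intro continuous_at_imp_continuous_on ballI DERIV_isCont[OF f_deriv])
  obtain C0 where C0: "\<forall>t\<in>{0..T}. \<forall>x. \<bar>w t x\<bar> \<le> C0" using bdd by blast
  define C where "C = max C0 \<bar>s1\<bar>"
  have wC: "w t x \<in> {-C..C}" if "0 \<le> t" "t \<le> T" for t x
  proof -
    have "\<bar>w t x\<bar> \<le> C" using C0[rule_format, of t x] that by (simp add: C_def)
    then show ?thesis by (simp add: abs_le_iff minus_le_iff)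
  qed
  have s1C: "s1 \<in> {-C..C}" by (auto simp: C_def abs_if)
  obtain L where L: "0 < L" "\<And>x y. x \<in> {-C..C} \<Longrightarrow> y \<in> {-C..C} \<Longrightarrow> \<bar>f x - f y\<bar> \<le> L * \<bar>x - y\<bar>"
    using C1_lipschitz_on_interval[OF f_deriv f'_cont] by metis
  \<comment> \<open>With this \<open>K\<close> the weighted gap \<open>z\<close> below satisfies
    \<open>z' \<le> L * (D - 3 * z)\<close> where it is positive, and the right-hand side is
    nonpositive as soon as \<open>z\<close> exceeds \<open>D / 2\<close>.\<close>
  define K where "K = 4 * L"
  define lam where "lam t = mean (\<lambda>y. f (w t y))" for t
  have f_near: "f s1 - L * (s1 - w t x) \<le> f (w t x)" "f (w t x) \<le> f s1 + L * (s1 - w t x)"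
    if "0 \<le> t" "t \<le> T" "w t x \<le> s1" for t x
    using L(2)[OF wC[OF that(1,2)] s1C, of x] that(3) by (auto simp: abs_le_iff algebra_simps)
  have improve: "s1 - w t x \<le> D / 2 * exp (K * t)"
    if D: "0 \<le> D" "\<And>t x. 0 \<le> t \<Longrightarrow> t \<le> T \<Longrightarrow> s1 - w t x \<le> D * exp (K * t)" and tT: "0 \<le> t" "t \<le> T" for D t x
  proof -
    have lam_le: "lam t \<le> f s1 + L * (D * exp (K * t))" if "0 \<le> t" "t \<le> T" for t
      unfolding lam_def
    proof (rule mean_le[OF nonnull])
      show "integrable M (\<lambda>y. f (w t y))"
        by (rule integrable_bounded_comp[OF w_meas f_cont wC]) (use that in auto)
      fix y
      have pos: "0 \<le> L * (D * exp (K * t))" using L(1) D(1) by simp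
      show "f (w t y) \<le> f s1 + L * (D * exp (K * t))"
      proof (cases "s1 \<le> w t y")
        case True
        then show ?thesis using f_le[OF True] pos by linarith
      next
        case False
        have "L * (s1 - w t y) \<le> L * (D * exp (K * t))" using D(2)[OF that] L(1) by (intro mult_left_mono) auto
        then show ?thesis using f_near(2)[OF that, of y] False by linarith
      qed
    qed
    \<comment> \<open>The weight turns the assumed bound \<open>D * exp (K * r)\<close> on the gap
      into the constant \<open>D\<close>, so that the improvement becomes the barrier
      \<open>D / 2\<close> for \<open>z\<close>.\<close>
    define z where "z r = (s1 - w r x) * exp (- K * r)" for r
    define z' where "z' r = (s1 - w r x) * (- K * exp (- K * r)) - (f (w r x) - lam r) * exp (- K * r)" for r
    have "z t \<le> D / 2"
    proof (rule stays_below_barrier[of T z z'])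
      show "continuous_on {0..T} z" unfolding z_def
        by (intro continuous_intros continuous_on_subset[OF cont]) auto
      show "(z has_real_derivative z' r) (at r)" if "0 < r" "r < T" for r
        unfolding z_def z'_def
        by (auto intro!: derivative_eq_intros ode[OF that(1)] simp: lam_def algebra_simps)
      show "z 0 \<le> D / 2" using init[of x] D(1) by (simp add: z_def)
      show "z' r \<le> 0" if r: "0 < r" "r < T" "D / 2 < z r" for r
      proof -
        have "0 < z r" using r(3) D(1) by linarith
        then have "w r x \<le> s1" by (simp add: z_def zero_less_mult_iff)
        then have "lam r - f (w r x) \<le> L * (s1 - w r x) + L * (D * exp (K * r))"
          using f_near(1)[of r x] lam_le[of r] r by simp
        then have "(lam r - f (w r x)) * exp (- K * r) \<le> (L * (s1 - w r x) + L * (D * exp (K * r))) * exp (- K * r)"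
          by (rule mult_right_mono) simp
        also have "\<dots> = L * z r + L * D"
          by (simp add: z_def algebra_simps flip: exp_add)
        finally have "z' r \<le> L * z r + L * D - K * z r"
          by (simp add: z'_def z_def algebra_simps)
        also have "\<dots> = L * (D - 3 * z r)" by (simp add: K_def algebra_simps)
        also have "\<dots> \<le> 0" using L(1) r(3) D(1) by (intro mult_nonneg_nonpos) auto
        finally show ?thesis .
      qed
      show "t \<in> {0..T}" using tT by simp
    qed
    then have "z t * exp (K * t) \<le> D / 2 * exp (K * t)" by (rule mult_right_mono) simp
    then show ?thesis by (simp add: z_def mult.assoc flip: exp_add)
  qed
  \<comment> \<open>The iteration starts at \<open>2 * C\<close> because \<open>s1\<close> and all
    values of \<open>w\<close> up to time \<open>T\<close> lie in \<open>{-C..C}\<close>.\<close>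
  define D where "D n = 2 * C * (1 / 2) ^ n" for n :: nat
  have "0 \<le> C" by (simp add: C_def)
  have iter: "s1 - w t x \<le> D n * exp (K * t)" if "0 \<le> t" "t \<le> T" for n t x
    using that
  proof (induction n arbitrary: t x)
    case 0
    have "s1 - w t x \<le> 2 * C * 1" using wC[OF 0, of x] s1C by auto
    also have "\<dots> \<le> 2 * C * exp (K * t)" using L(1) 0 \<open>0 \<le> C\<close> by (intro mult_left_mono) (auto simp: K_def)
    finally show ?case by (simp add: D_def)
  next
    case (Suc n)
    have "s1 - w t x \<le> D n / 2 * exp (K * t)"
      by (rule improve) (use Suc \<open>0 \<le> C\<close> in \<open>auto simp: D_def\<close>)
    then show ?case by (simp add: D_def)
  qed
  have "(\<lambda>n. 2 * C * (1 / 2) ^ n * exp (K * T)) \<longlonglongrightarrow> 2 * C * 0 * exp (K * T)"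
    by (intro tendsto_intros LIMSEQ_power_zero) auto
  then have "(\<lambda>n. D n * exp (K * T)) \<longlonglongrightarrow> 0" by (simp add: D_def)
  then have "s1 - w T x \<le> 0"
    by (rule LIMSEQ_le_const) (use iter[OF \<open>0 \<le> T\<close>] in auto)
  then show ?thesis by simp
qed

end

section \<open>Order preservation and dissipation\<close>

locale confined_flow = finite_measure M for M :: "'a measure" +
  fixes f f' :: "real \<Rightarrow> real" and s1 s2 :: real and w :: "real \<Rightarrow> 'a \<Rightarrow> real"
  assumes nonnull: "0 < measure M (space M)"
    and f_deriv: "\<And>s. (f has_real_derivative f' s) (at s)" and f'_cont: "continuous_on UNIV f'"
    and f_le: "\<And>s. s1 \<le> s \<Longrightarrow> f s \<le> f s1" and f_ge: "\<And>s. s \<le> s2 \<Longrightarrow> f s2 \<le> f s"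
    and w_meas: "\<And>t. 0 \<le> t \<Longrightarrow> w t \<in> borel_measurable M"
    and ode: "\<And>x t. 0 < t \<Longrightarrow> ((\<lambda>t. w t x) has_real_derivative f (w t x) - mean (\<lambda>y. f (w t y))) (at t)"
    and w_cont: "\<And>x. continuous_on {0..} (\<lambda>t. w t x)"
    and w_bdd: "\<And>T. \<exists>C. \<forall>t\<in>{0..T}. \<forall>x. \<bar>w t x\<bar> \<le> C"
    and w_init: "\<And>x. w 0 x \<in> {s1..s2}"
begin

abbreviation lam :: "real \<Rightarrow> real" where
  "lam t \<equiv> mean (\<lambda>y. f (w t y))"

lemma f_cont: "continuous_on UNIV f"
  by (intro continuous_at_imp_continuous_on ballI DERIV_isCont[OF f_deriv])

lemma f_isCont: "isCont f s"
  by (rule DERIV_isCont[OF f_deriv])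

text \<open>The upper bound is the lower barrier for the reflected flow \<open>-w\<close>.\<close>

lemma w_range:
  assumes "0 \<le> t"
  shows "w t x \<in> {s1..s2}"
proof -
  have "s1 \<le> w t x"
    by (rule lower_barrier[OF nonnull f_deriv f'_cont f_le w_meas ode w_cont w_bdd _ assms])
      (use w_init in auto)
  moreover have "- s2 \<le> - w t x"
  \<comment> \<open>The reflected nonlinearity \<open>- f (- s)\<close> has derivative
    \<open>f' (- s)\<close>, and \<open>f_ge\<close> takes over the part of \<open>f_le\<close> at
    the level \<open>- s2\<close>.\<close>
  proof (rule lower_barrier[where f = "\<lambda>s. - f (- s)" and f' = "\<lambda>s. f' (- s)" and w = "\<lambda>t x. - w t x", OF nonnull])
    show "((\<lambda>s. - f (- s)) has_real_derivative f' (- s)) (at s)" for s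
      by (auto intro!: derivative_eq_intros DERIV_chain2[OF f_deriv])
    show "continuous_on UNIV (\<lambda>s. f' (- s))"
      by (intro continuous_on_compose2[OF f'_cont] continuous_intros) auto
    show "- f (- s) \<le> - f (- (- s2))" if "- s2 \<le> s" for s using f_ge[of "- s"] that by simp
    show "((\<lambda>t. - w t x) has_real_derivative - f (- (- w t x)) - mean (\<lambda>y. - f (- (- w t y)))) (at t)" if "0 < t" for x t
      using DERIV_minus[OF ode[OF that, of x]] by (simp add: mean_uminus)
    show "continuous_on {0..} (\<lambda>t. - w t x)" for x by (intro continuous_intros w_cont)
    show "\<exists>C. \<forall>t\<in>{0..T}. \<forall>x. \<bar>- w t x\<bar> \<le> C" for T using w_bdd by simp
    show "- s2 \<le> - w 0 x" for x using w_init[of x] by simp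
  qed (use w_meas assms in auto)
  ultimately show ?thesis by simp
qed

lemma integrable_comp:
  fixes h :: "real \<Rightarrow> real"
  assumes "0 \<le> t" "continuous_on UNIV h"
  shows "integrable M (\<lambda>x. h (w t x))"
  by (rule integrable_bounded_comp[OF w_meas[OF assms(1)] assms(2) w_range[OF assms(1)]])

lemma integrable_w: "0 \<le> t \<Longrightarrow> integrable M (w t)"
  using integrable_comp[of t "\<lambda>x. x"] by simp

text \<open>The nonlocal term is the same for both paths and cancels in their difference. What
  remains is controlled by the Lipschitz constant of \<open>f\<close> on the strip, so
  \<open>exp (- L * t)\<close> times the difference cannot grow while it is positive.\<close>

lemma order_preserved:
  assumes "0 \<le> T" and le: "w 0 x \<le> w 0 y"
  shows "w T x \<le> w T y"
proof -
  obtain L where L: "0 < L" "\<And>a b. a \<in> {s1..s2} \<Longrightarrow> b \<in> {s1..s2} \<Longrightarrow> \<bar>f a - f b\<bar> \<le> L * \<bar>a - b\<bar>"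
    using C1_lipschitz_on_interval[OF f_deriv f'_cont] by metis
  define z where "z t = (w t x - w t y) * exp (- L * t)" for t
  define z' where "z' t = (f (w t x) - f (w t y) - L * (w t x - w t y)) * exp (- L * t)" for t
  have "z T \<le> 0"
  proof (rule stays_below_barrier[of T z z'])
    show "continuous_on {0..T} z" unfolding z_def
      by (intro continuous_intros continuous_on_subset[OF w_cont]) auto
    show "(z has_real_derivative z' t) (at t)" if "0 < t" for t
      unfolding z_def z'_def
      by (auto intro!: derivative_eq_intros ode[OF that] simp: algebra_simps)
    show "z' t \<le> 0" if t: "0 < t" "0 < z t" for t
    proof -
      have "w t y \<le> w t x" using t(2) by (simp add: z_def zero_less_mult_iff)
      then have "f (w t x) - f (w t y) \<le> L * (w t x - w t y)"
        using L(2)[OF w_range w_range, of t t x y] t(1) by (simp add: abs_le_iff)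
      then show ?thesis unfolding z'_def by (intro mult_nonpos_nonneg) auto
    qed
  qed (use le assms(1) in \<open>auto simp: z_def\<close>)
  then show ?thesis by (simp add: z_def mult_le_0_iff)
qed

text \<open>\<open>w t\<close> is a monotone function of the initial value, so Helly's theorem applies.\<close>

lemma convergent_subsequence:
  fixes t :: "nat \<Rightarrow> real"
  assumes t: "\<And>n. 0 \<le> t n"
  obtains r \<psi> where "strict_mono (r :: nat \<Rightarrow> nat)" "\<psi> \<in> borel_measurable M" "\<And>x. \<psi> x \<in> {s1..s2}"
    "\<And>x. (\<lambda>n. w (t (r n)) x) \<longlonglongrightarrow> \<psi> x"
proof -
  \<comment> \<open>This extends the map from \<open>w 0 x\<close> to \<open>w (t n) x\<close>
    monotonically to all real levels; inserting \<open>s1\<close> gives a value at levels below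
    every initial value.\<close>
  define Y where "Y n s = Sup (insert s1 {w (t n) x | x. w 0 x \<le> s})" for n s
  have s12: "s1 \<le> s2" using w_init by force
  have bdd: "bdd_above (insert s1 {w (t n) x | x. w 0 x \<le> s})" for n s
    using w_range[OF t] s12 by (intro bdd_aboveI[of _ s2]) auto
  have "mono (Y n)" for n
    unfolding Y_def by (intro monoI cSup_subset_mono bdd) (auto intro: order_trans)
  moreover have "Y n s \<in> {s1..s2}" for n s
  proof -
    have "Y n s \<le> s2" unfolding Y_def by (rule cSup_least) (use w_range[OF t] s12 in auto)
    moreover have "s1 \<le> Y n s" unfolding Y_def by (rule cSup_upper) (use bdd in auto)
    ultimately show ?thesis by simp
  qed
  ultimately obtain r :: "nat \<Rightarrow> nat" where r: "strict_mono r" "\<And>s. convergent (\<lambda>n. Y (r n) s)"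
    using Helly_selection_everywhere[of Y s1 s2] by metis
  have Y_w: "Y n (w 0 x) = w (t n) x" for n x
    unfolding Y_def
  proof (rule cSup_eq_maximum)
    show "w (t n) x \<in> insert s1 {w (t n) y | y. w 0 y \<le> w 0 x}" by auto
    show "y \<le> w (t n) x" if "y \<in> insert s1 {w (t n) y | y. w 0 y \<le> w 0 x}" for y
      using that w_range[OF t, of n x] order_preserved[OF t, of _ x n] by auto
  qed
  define \<psi> where "\<psi> x = lim (\<lambda>n. w (t (r n)) x)" for x
  have lim: "(\<lambda>n. w (t (r n)) x) \<longlonglongrightarrow> \<psi> x" for x
    using r(2)[of "w 0 x"] unfolding \<psi>_def Y_w by (simp add: convergent_LIMSEQ_iff)
  show ?thesis
  proof (rule that[OF r(1) _ _ lim])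
    show "\<psi> \<in> borel_measurable M"
      by (rule borel_measurable_LIMSEQ_real[OF lim w_meas[OF t]])
    show "\<psi> x \<in> {s1..s2}" for x
      using LIMSEQ_le_const[OF lim, of s1 x] LIMSEQ_le_const2[OF lim, of x s2] w_range[OF t] by auto
  qed
qed

lemma bounds:
  obtains B L where "0 < B" "0 < L" "\<And>a. a \<in> {s1..s2} \<Longrightarrow> \<bar>f a\<bar> \<le> B"
    "\<And>a b. a \<in> {s1..s2} \<Longrightarrow> b \<in> {s1..s2} \<Longrightarrow> \<bar>f a - f b\<bar> \<le> L * \<bar>a - b\<bar>"
proof -
  obtain L where L: "0 < L" "\<And>a b. a \<in> {s1..s2} \<Longrightarrow> b \<in> {s1..s2} \<Longrightarrow> \<bar>f a - f b\<bar> \<le> L * \<bar>a - b\<bar>"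
    using C1_lipschitz_on_interval[OF f_deriv f'_cont] by metis
  have "bounded (f ` {s1..s2})"
    by (intro compact_imp_bounded compact_continuous_image continuous_on_subset[OF f_cont]) auto
  then obtain B where "0 < B" "\<forall>a\<in>{s1..s2}. \<bar>f a\<bar> \<le> B" unfolding bounded_pos by auto
  then show ?thesis using that[of B L] L by blast
qed

lemma abs_lam_le:
  assumes "\<And>a. a \<in> {s1..s2} \<Longrightarrow> \<bar>f a\<bar> \<le> B" "0 \<le> t"
  shows "\<bar>lam t\<bar> \<le> B"
proof -
  have "f (w t x) \<le> B" "- B \<le> f (w t x)" for x
    using assms(1)[OF w_range[OF assms(2), of x]] by auto
  then have "lam t \<le> B" "- B \<le> lam t"
    using mean_le[OF nonnull integrable_comp[OF assms(2) f_cont], of B]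
      mean_ge[OF nonnull integrable_comp[OF assms(2) f_cont], of "- B"] by auto
  then show ?thesis by simp
qed

lemma w_Lipschitz:
  obtains K where "0 < K" "\<And>s t x. 0 \<le> s \<Longrightarrow> 0 \<le> t \<Longrightarrow> \<bar>w s x - w t x\<bar> \<le> K * \<bar>s - t\<bar>"
proof -
  obtain B L where B: "0 < B" "\<And>a. a \<in> {s1..s2} \<Longrightarrow> \<bar>f a\<bar> \<le> B"
    using bounds by metis
  show ?thesis
  proof (rule that[of "2 * B"])
    show "\<bar>w s x - w t x\<bar> \<le> 2 * B * \<bar>s - t\<bar>" if "0 \<le> s" "0 \<le> t" for s t x
    proof (rule Lipschitz_from_derivative_bound[OF w_cont ode _ that])
      fix r :: real assume "0 < r"
      then show "\<bar>f (w r x) - lam r\<bar> \<le> 2 * B"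
        using B(2)[OF w_range, of r x] abs_lam_le[OF B(2), of r] by linarith
    qed
  qed (use B in simp)
qed

definition dissipation :: "real \<Rightarrow> real" where
  "dissipation t = (LINT x|M. (f (w t x) - lam t)\<^sup>2)"

lemma dissipation_nonneg: "0 \<le> dissipation t"
  unfolding dissipation_def by (intro integral_nonneg_AE) auto

text \<open>The two integrands differ by \<open>lam t * (f (w t x) - lam t)\<close>, whose integral
  vanishes because \<open>lam t\<close> is the mean.\<close>

lemma dissipation_eq:
  assumes "0 \<le> t"
  shows "(LINT x|M. f (w t x) * (f (w t x) - lam t)) = dissipation t"
proof -
  note i = integrable_comp[OF assms f_cont]
  have "integrable M (\<lambda>x. (\<lambda>s. f s * f s) (w t x))"
    by (intro integrable_comp assms continuous_intros f_cont)
  then have i2: "integrable M (\<lambda>x. f (w t x) * f (w t x))" by simp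
  have m: "(LINT x|M. f (w t x)) = lam t * measure M (space M)"
    using nonnull by (simp add: mean_def)
  have "(f (w t x) - lam t)\<^sup>2 = f (w t x) * (f (w t x) - lam t) - (lam t * f (w t x) - lam t * lam t)" for x
    by (simp add: power2_eq_square algebra_simps)
  then have "dissipation t = (LINT x|M. f (w t x) * (f (w t x) - lam t) - (lam t * f (w t x) - lam t * lam t))"
    unfolding dissipation_def by simp
  also have "\<dots> = (LINT x|M. f (w t x) * (f (w t x) - lam t)) - (LINT x|M. lam t * f (w t x) - lam t * lam t)"
    using i i2 by (intro Bochner_Integration.integral_diff) (auto simp: right_diff_distrib)
  also have "(LINT x|M. lam t * f (w t x) - lam t * lam t) = 0"
    using i m by simp
  finally show ?thesis by simp
qed

text \<open>With \<open>F\<close> an antiderivative of \<open>f\<close>, the derivative of \<open>\<integral> F(w)\<close> is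
  \<open>\<integral> f(w) (f(w) - lam) = \<integral> (f(w) - lam)\<^sup>2\<close>.\<close>

lemma dissipation_tendsto_0: "(dissipation \<longlongrightarrow> 0) at_top"
proof -
  obtain B L where B: "0 < B" "\<And>a. a \<in> {s1..s2} \<Longrightarrow> \<bar>f a\<bar> \<le> B" and L: "0 < L"
    "\<And>a b. a \<in> {s1..s2} \<Longrightarrow> b \<in> {s1..s2} \<Longrightarrow> \<bar>f a - f b\<bar> \<le> L * \<bar>a - b\<bar>"
    using bounds by metis
  obtain K where K: "0 < K" "\<And>s t x. 0 \<le> s \<Longrightarrow> 0 \<le> t \<Longrightarrow> \<bar>w s x - w t x\<bar> \<le> K * \<bar>s - t\<bar>"
    using w_Lipschitz by metis
  let ?m = "measure M (space M)"
  have "\<exists>F. \<forall>x::real. -\<infinity> < ereal x \<longrightarrow> ereal x < \<infinity> \<longrightarrow> (F has_vector_derivative f x) (at x)"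
    by (rule einterval_antiderivative) (auto intro: f_isCont)
  then obtain F where F: "\<And>s. (F has_real_derivative f s) (at s)"
    by (auto simp: has_real_derivative_iff_has_vector_derivative)
  have F_cont: "continuous_on UNIV F"
    by (intro continuous_at_imp_continuous_on ballI DERIV_isCont[OF F])
  have "bounded (F ` {s1..s2})"
    by (intro compact_imp_bounded compact_continuous_image continuous_on_subset[OF F_cont]) auto
  then obtain BF where BF: "\<forall>a\<in>{s1..s2}. \<bar>F a\<bar> \<le> BF" unfolding bounded_iff by auto

  define g where "g t x = f (w t x) * (f (w t x) - lam t)" for t x
  have f_Lip: "\<bar>f (w s x) - f (w t x)\<bar> \<le> L * K * \<bar>s - t\<bar>" if "0 \<le> s" "0 \<le> t" for s t x
  proof -
    have "\<bar>f (w s x) - f (w t x)\<bar> \<le> L * \<bar>w s x - w t x\<bar>" using L(2) w_range that by blast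
    also have "\<dots> \<le> L * (K * \<bar>s - t\<bar>)" using K(2)[OF that] L(1) by (intro mult_left_mono) auto
    finally show ?thesis by (simp add: mult.assoc)
  qed
  have lam_Lip: "\<bar>lam s - lam t\<bar> \<le> L * K * \<bar>s - t\<bar>" if "0 \<le> s" "0 \<le> t" for s t
  proof -
    note i = integrable_comp[OF that(1) f_cont] integrable_comp[OF that(2) f_cont]
    have b: "f (w s y) - f (w t y) \<le> L * K * \<bar>s - t\<bar>" "- (L * K * \<bar>s - t\<bar>) \<le> f (w s y) - f (w t y)" for y
      using f_Lip[OF that, of y] by linarith+
    have "mean (\<lambda>y. f (w s y) - f (w t y)) \<le> L * K * \<bar>s - t\<bar>"
      by (rule mean_le[OF nonnull Bochner_Integration.integrable_diff[OF i] b(1)])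
    moreover have "- (L * K * \<bar>s - t\<bar>) \<le> mean (\<lambda>y. f (w s y) - f (w t y))"
      by (rule mean_ge[OF nonnull Bochner_Integration.integrable_diff[OF i] b(2)])
    ultimately show ?thesis unfolding mean_diff[OF i] by simp
  qed
  \<comment> \<open>\<open>Q\<close> is a Lipschitz constant in time for \<open>g\<close>: by the
    product rule, \<open>B\<close> times \<open>2 * L * K\<close> plus \<open>L * K\<close> times
    \<open>2 * B\<close>.\<close>
  define Q where "Q = 4 * B * (L * K)"
  have "0 < Q" using B(1) L(1) K(1) by (simp add: Q_def)
  have g_Lip: "\<bar>g s x - g t x\<bar> \<le> Q * \<bar>s - t\<bar>" if "0 \<le> s" "0 \<le> t" for s t x
  proof -
    let ?h = "L * K * \<bar>s - t\<bar>"
    have h: "\<bar>f (w s x) - f (w t x)\<bar> \<le> ?h" "\<bar>(f (w s x) - lam s) - (f (w t x) - lam t)\<bar> \<le> 2 * ?h"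
      using f_Lip[OF that, of x] lam_Lip[OF that] by linarith+
    have b: "\<bar>f (w s x)\<bar> \<le> B" "\<bar>f (w t x) - lam t\<bar> \<le> 2 * B"
      using B(2)[OF w_range[OF that(1), of x]] B(2)[OF w_range[OF that(2), of x]] abs_lam_le[OF B(2) that(2)] by linarith+
    have "g s x - g t x = f (w s x) * ((f (w s x) - lam s) - (f (w t x) - lam t)) + (f (w s x) - f (w t x)) * (f (w t x) - lam t)"
      by (simp add: g_def algebra_simps)
    also have "\<bar>\<dots>\<bar> \<le> \<bar>f (w s x)\<bar> * \<bar>(f (w s x) - lam s) - (f (w t x) - lam t)\<bar> + \<bar>f (w s x) - f (w t x)\<bar> * \<bar>f (w t x) - lam t\<bar>"
      by (simp add: abs_triangle_ineq flip: abs_mult)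
    also have "\<dots> \<le> B * (2 * ?h) + ?h * (2 * B)"
      by (intro add_mono mult_mono h b) (use B(1) L(1) K(1) in auto)
    finally show ?thesis by (simp add: Q_def algebra_simps)
  qed
  \<comment> \<open>The quadratic remainder has a constant independent of \<open>x\<close>, so it
    can be integrated; this yields the derivative of \<open>J\<close> and also a lower bound for the
    increase of \<open>J\<close> over steps of fixed length.\<close>
  have Taylor: "\<bar>F (w s x) - F (w t x) - (s - t) * g t x\<bar> \<le> Q * (s - t)\<^sup>2" if st: "0 < s" "0 < t" for s t x
  proof -
    have d: "((\<lambda>r. F (w r x)) has_real_derivative g r x) (at r)" if "0 < r" for r
      unfolding g_def by (rule DERIV_chain2[OF F ode[OF that]])
    have mvt: "\<exists>r>0. \<bar>r - c\<bar> \<le> \<bar>b - a\<bar> \<and> F (w b x) - F (w a x) = (b - a) * g r x"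
      if abc: "0 < a" "a < b" "c = a \<or> c = b" for a b c
    proof -
      obtain r where "a < r" "r < b" "F (w b x) - F (w a x) = (b - a) * g r x"
        using MVT2[OF abc(2), of "\<lambda>r. F (w r x)" "\<lambda>r. g r x"] d abc(1) by auto
      then show ?thesis using abc by (intro exI[of _ r]) auto
    qed
    obtain r where r: "0 < r" "\<bar>r - t\<bar> \<le> \<bar>s - t\<bar>" "F (w s x) - F (w t x) = (s - t) * g r x"
    proof (cases s t rule: linorder_cases)
      case less
      then obtain r where "0 < r" "\<bar>r - t\<bar> \<le> \<bar>t - s\<bar>" "F (w t x) - F (w s x) = (t - s) * g r x"
        using mvt[of s t t] st by blast
      then show ?thesis by (intro that[of r]) (auto simp: algebra_simps)
    next
      case equal
      then show ?thesis using st by (intro that[of s]) auto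
    next
      case greater
      then show ?thesis using mvt[of t s t] st that by blast
    qed
    have "\<bar>F (w s x) - F (w t x) - (s - t) * g t x\<bar> = \<bar>s - t\<bar> * \<bar>g r x - g t x\<bar>"
      using r(3) by (simp add: right_diff_distrib flip: abs_mult)
    also have "\<dots> \<le> \<bar>s - t\<bar> * (Q * \<bar>r - t\<bar>)" using g_Lip[of r t x] r(1) st by (intro mult_left_mono) auto
    also have "\<dots> \<le> \<bar>s - t\<bar> * (Q * \<bar>s - t\<bar>)" using r(2) \<open>0 < Q\<close> by (intro mult_left_mono) auto
    also have "\<dots> = Q * (s - t)\<^sup>2" by (simp add: power2_eq_square mult_ac flip: abs_mult)
    finally show ?thesis .
  qed

  define J where "J t = (LINT x|M. F (w t x))" for t
  have J_Taylor: "\<bar>J s - J t - (s - t) * dissipation t\<bar> \<le> Q * ?m * (s - t)\<^sup>2" if st: "0 < s" "0 < t" for s t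
  proof -
    have st': "0 \<le> s" "0 \<le> t" using st by auto
    have ig: "integrable M (\<lambda>x. g t x)"
      unfolding g_def
      by (rule integrable_comp[OF st'(2), of "\<lambda>a. f a * (f a - lam t)"]) (intro continuous_intros f_cont)
    note i = integrable_comp[OF st'(1) F_cont] integrable_comp[OF st'(2) F_cont] ig
    have "J s - J t - (s - t) * dissipation t = (LINT x|M. F (w s x) - F (w t x) - (s - t) * g t x)"
      unfolding J_def dissipation_eq[OF st'(2), symmetric] using i by (simp add: g_def[symmetric])
    also have "\<bar>\<dots>\<bar> \<le> (LINT x|M. \<bar>F (w s x) - F (w t x) - (s - t) * g t x\<bar>)"
      by (rule integral_abs_bound)
    also have "\<dots> \<le> (LINT x|M. Q * (s - t)\<^sup>2)"
      by (rule integral_mono) (use i Taylor[OF st] in auto)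
    finally show ?thesis by (simp add: mult_ac)
  qed
  have J_deriv: "(J has_real_derivative dissipation t) (at t)" if t: "0 < t" for t
    unfolding has_field_derivative_iff
  proof (rule LIM_zero_cancel, rule Lim_null_comparison)
    show "\<forall>\<^sub>F s in at t. norm ((J s - J t) / (s - t) - dissipation t) \<le> Q * ?m * \<bar>s - t\<bar>"
    proof -
      have "\<forall>\<^sub>F s in at t. 0 < s" using order_tendstoD(1)[OF tendsto_ident_at t] .
      moreover have "\<forall>\<^sub>F s in at t. s \<noteq> t" by (simp add: eventually_at_filter)
      ultimately show ?thesis
      proof eventually_elim
        case (elim s)
        have "(J s - J t) / (s - t) - dissipation t = (J s - J t - (s - t) * dissipation t) / (s - t)"
          using elim by (simp add: field_simps)
        then show ?case using J_Taylor[OF elim(1) t] elim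
          by (simp add: abs_divide pos_divide_le_eq power2_eq_square mult.assoc flip: abs_mult)
      qed
    qed
    have "((\<lambda>s. Q * ?m * \<bar>s - t\<bar>) \<longlongrightarrow> Q * ?m * \<bar>t - t\<bar>) (at t)" by (intro tendsto_intros)
    then show "((\<lambda>s. Q * ?m * \<bar>s - t\<bar>) \<longlongrightarrow> 0) (at t)" by simp
  qed
  have J_mono: "J a \<le> J b" if "0 < a" "a \<le> b" for a b
    by (rule DERIV_nonneg_imp_nondecreasing[OF that(2)])
      (use that J_deriv dissipation_nonneg in \<open>meson less_le_trans\<close>)
  have J_bdd: "J t \<le> BF * ?m" if "0 \<le> t" for t
  proof -
    have "J t \<le> (LINT x|M. BF)" unfolding J_def
      by (rule integral_mono) (use integrable_comp[OF that F_cont] BF w_range[OF that] in \<open>auto simp: abs_le_iff\<close>)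
    then show ?thesis by (simp add: mult.commute)
  qed
  define S where "S = (SUP t\<in>{0<..}. J t)"
  have bdd: "bdd_above (J ` {0<..})" using J_bdd by (intro bdd_aboveI2[of _ _ "BF * ?m"]) auto
  have J_le: "J t \<le> S" if "0 < t" for t unfolding S_def by (rule cSUP_upper[OF _ bdd]) (use that in simp)
  show ?thesis
  proof (rule tendstoI)
    fix e :: real assume "0 < e"
    \<comment> \<open>Over a step \<open>h\<close>, \<open>J\<close> grows by at least
      \<open>h * dissipation t\<close> minus \<open>e / 4 * h\<close>. Beyond \<open>T\<close> the
      total growth left is less than \<open>e / 4 * h\<close>, so the dissipation is at most
      \<open>e / 2\<close>.\<close>
    define h where "h = e / (4 * Q * ?m)"
    have h: "0 < h" "Q * ?m * h = e / 4" using \<open>0 < e\<close> \<open>0 < Q\<close> nonnull by (auto simp: h_def)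
    have "S - e / 4 * h < S" using h(1) \<open>0 < e\<close> by simp
    then obtain T where T: "0 < T" "S - e / 4 * h < J T"
      unfolding S_def using less_cSUP_iff[OF _ bdd] by auto
    have "dist (dissipation t) 0 < e" if t: "T \<le> t" for t
    proof -
      have t0: "0 < t" "0 < t + h" using T(1) t h(1) by auto
      have "h * dissipation t \<le> J (t + h) - J t + Q * ?m * h\<^sup>2" using J_Taylor[OF t0(2,1)] by (simp add: abs_le_iff)
      also have "\<dots> \<le> e / 4 * h + (Q * ?m * h) * h"
        using J_le[OF t0(2)] J_mono[OF T(1) t] T(2) by (simp add: power2_eq_square mult_ac)
      also have "\<dots> = h * (e / 2)" unfolding h(2) by simp
      finally have "dissipation t \<le> e / 2" using h(1) by (simp add: mult_le_cancel_left_pos)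
      then show ?thesis using dissipation_nonneg[of t] \<open>0 < e\<close> by (simp add: dist_real_def)
    qed
    then show "\<forall>\<^sub>F t in at_top. dist (dissipation t) 0 < e"
      by (rule eventually_mono[OF eventually_ge_at_top[of T]])
  qed
qed

text \<open>By dominated convergence the dissipation passes to the limit, first in the mean and then
  in the square. The limit integral is therefore 0, and so is its nonnegative integrand almost
  everywhere.\<close>

lemma limit_stationary:
  assumes t: "\<And>n. 0 \<le> t n" "filterlim t at_top sequentially"
    and \<psi>: "\<psi> \<in> borel_measurable M" and lim: "\<And>x. (\<lambda>n. w (t n) x) \<longlonglongrightarrow> \<psi> x"
  shows "AE x in M. f (\<psi> x) - mean (\<lambda>y. f (\<psi> y)) = 0"
proof -
  obtain B L where B: "0 < B" "\<And>a. a \<in> {s1..s2} \<Longrightarrow> \<bar>f a\<bar> \<le> B"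
    using bounds by metis
  have f_meas: "f \<in> borel_measurable borel" by (rule borel_measurable_continuous_onI[OF f_cont])
  have f_lim: "(\<lambda>n. f (w (t n) x)) \<longlonglongrightarrow> f (\<psi> x)" for x
    using isCont_tendsto_compose[OF f_isCont lim] .
  have fw_meas: "(\<lambda>x. f (w (t n) x)) \<in> borel_measurable M" for n
    by (rule measurable_compose[OF w_meas[OF t(1)] f_meas])
  have f\<psi>_meas: "(\<lambda>x. f (\<psi> x)) \<in> borel_measurable M"
    by (rule measurable_compose[OF \<psi> f_meas])
  have fw_bd: "\<bar>f (w (t n) x)\<bar> \<le> B" for n x using B(2) w_range[OF t(1)] by blast
  have "(\<lambda>n. LINT x|M. f (w (t n) x)) \<longlonglongrightarrow> (LINT x|M. f (\<psi> x))"
    by (rule integral_dominated_convergence[where w = "\<lambda>_. B"]) (use f\<psi>_meas fw_meas f_lim fw_bd in auto)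
  then have lam_lim: "(\<lambda>n. lam (t n)) \<longlonglongrightarrow> mean (\<lambda>y. f (\<psi> y))"
    unfolding mean_def by (intro tendsto_intros)
  let ?k = "\<lambda>x. (f (\<psi> x) - mean (\<lambda>y. f (\<psi> y)))\<^sup>2"
  have dom: "\<bar>(f (w (t n) x) - lam (t n))\<^sup>2\<bar> \<le> (2 * B)\<^sup>2" for n x
  proof -
    have "\<bar>f (w (t n) x) - lam (t n)\<bar> \<le> 2 * B" using fw_bd[of n x] abs_lam_le[OF B(2) t(1), of n] by linarith
    then show ?thesis using abs_le_square_iff[of _ "2 * B"] B(1) by simp
  qed
  have k_meas: "?k \<in> borel_measurable M" using f\<psi>_meas by measurable
  have kn_meas: "(\<lambda>x. (f (w (t n) x) - lam (t n))\<^sup>2) \<in> borel_measurable M" for n using fw_meas[of n] by measurable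
  have k_lim: "AE x in M. (\<lambda>n. (f (w (t n) x) - lam (t n))\<^sup>2) \<longlonglongrightarrow> ?k x"
    by (intro AE_I2 tendsto_intros f_lim lam_lim)
  have k_dom: "AE x in M. norm ((f (w (t n) x) - lam (t n))\<^sup>2) \<le> (2 * B)\<^sup>2" for n using dom by simp
  have "integrable M (\<lambda>x. (2 * B)\<^sup>2)" by simp
  note dct = k_meas kn_meas this k_lim k_dom
  have k_int: "integrable M ?k" by (rule integrable_dominated_convergence[OF dct])
  have "(\<lambda>n. dissipation (t n)) \<longlonglongrightarrow> (LINT x|M. ?k x)"
    unfolding dissipation_def by (rule integral_dominated_convergence[OF dct])
  moreover have "(\<lambda>n. dissipation (t n)) \<longlonglongrightarrow> 0"
    by (rule filterlim_compose[OF dissipation_tendsto_0 t(2)])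
  ultimately have "(LINT x|M. ?k x) = 0" by (rule LIMSEQ_unique)
  then have "AE x in M. ?k x = 0" using integral_nonneg_eq_0_iff_AE[OF k_int] by simp
  then show ?thesis by simp
qed

end

section \<open>Limit sets\<close>

context Metric_space
begin

definition omega_set :: "(real \<Rightarrow> 'a) \<Rightarrow> 'a set" where
  "omega_set c = {\<phi> \<in> M. \<exists>t :: nat \<Rightarrow> real. (\<forall>n. 0 \<le> t n) \<and> filterlim t at_top sequentially \<and>
     limitin mtopology (\<lambda>n. c (t n)) \<phi> sequentially}"

context
  fixes c :: "real \<Rightarrow> 'a"
  assumes precompact: "\<And>t :: nat \<Rightarrow> real. (\<And>n. 0 \<le> t n) \<Longrightarrow>
      \<exists>r \<phi>. strict_mono r \<and> limitin mtopology (\<lambda>n. c (t (r n))) \<phi> sequentially"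
begin

text \<open>The requirement \<open>real n \<le> t n\<close> forces the times to infinity, so a limit
  supplied by \<open>precompact\<close> is automatically a point of
  \<open>omega_set c\<close>.\<close>

lemma omega_set_subsequence:
  fixes t :: "nat \<Rightarrow> real"
  assumes t: "\<And>n. real n \<le> t n"
  obtains r \<phi> where "strict_mono (r :: nat \<Rightarrow> nat)" "\<phi> \<in> omega_set c" "limitin mtopology (\<lambda>n. c (t (r n))) \<phi> sequentially"
proof -
  have t0: "0 \<le> t n" for n using t[of n] by simp
  obtain r \<phi> where r: "strict_mono r" "limitin mtopology (\<lambda>n. c (t (r n))) \<phi> sequentially"
    using precompact[of t, OF t0] by blast
  have "filterlim t at_top sequentially"
    by (rule filterlim_at_top_mono[OF filterlim_real_sequentially]) (use t in auto)
  then have "filterlim (\<lambda>n. t (r n)) at_top sequentially"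
    by (rule filterlim_compose[OF _ filterlim_subseq[OF r(1)]])
  then have "\<phi> \<in> omega_set c"
    unfolding omega_set_def using r(2) t0 limitin_mspace[OF r(2)]
    by (intro CollectI conjI exI[of _ "\<lambda>n. t (r n)"]) simp_all
  then show ?thesis using that r by blast
qed

lemma omega_set_nonempty: "omega_set c \<noteq> {}"
proof -
  obtain \<phi> where "\<phi> \<in> omega_set c" by (rule omega_set_subsequence[of real]) auto
  then show ?thesis by blast
qed

lemma omega_set_approx:
  assumes "\<phi> \<in> omega_set c" "openin mtopology U" "\<phi> \<in> U"
  obtains t where "T \<le> t" "0 \<le> t" "c t \<in> U"
proof -
  obtain t :: "nat \<Rightarrow> real" where t: "\<And>n. 0 \<le> t n" "filterlim t at_top sequentially"
    "limitin mtopology (\<lambda>n. c (t n)) \<phi> sequentially"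
    using assms(1) unfolding omega_set_def by blast
  have "\<forall>\<^sub>F n in sequentially. c (t n) \<in> U" using t(3) assms(2,3) unfolding limitin_def by blast
  moreover have "\<forall>\<^sub>F n in sequentially. T \<le> t n" using t(2) unfolding filterlim_at_top by blast
  ultimately have "\<forall>\<^sub>F n in sequentially. c (t n) \<in> U \<and> T \<le> t n" by (rule eventually_conj)
  then obtain n where "c (t n) \<in> U" "T \<le> t n"
    using eventually_happens'[OF sequentially_bot] by blast
  then show ?thesis using that[of "t n"] t(1) by blast
qed

text \<open>A sequence in the limit set is shadowed by points of the curve at times at least
  \<open>n\<close>, at distance less than \<open>1 / (n + 1)\<close>; a limit of the shadows along a
  subsequence is also a limit of the sequence.\<close>

lemma compactin_omega_set: "compactin mtopology (omega_set c)"
  unfolding compactin_sequentially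
proof (intro conjI allI impI)
  show "omega_set c \<subseteq> M" unfolding omega_set_def by blast
next
  fix \<sigma> :: "nat \<Rightarrow> 'a" assume \<sigma>: "range \<sigma> \<subseteq> omega_set c"
  have \<sigma>M: "\<sigma> n \<in> M" for n using \<sigma> unfolding omega_set_def by blast
  have "\<exists>t. real n \<le> t \<and> c t \<in> mball (\<sigma> n) (1 / real (Suc n))" for n
  proof -
    have "\<sigma> n \<in> omega_set c" "\<sigma> n \<in> mball (\<sigma> n) (1 / real (Suc n))" using \<sigma> \<sigma>M[of n] by auto
    then show ?thesis using omega_set_approx[OF _ openin_mball] by metis
  qed
  then obtain t where t: "\<And>n. real n \<le> t n" "\<And>n. c (t n) \<in> mball (\<sigma> n) (1 / real (Suc n))"
    by metis
  obtain r \<phi> where r: "strict_mono r" "\<phi> \<in> omega_set c" "limitin mtopology (\<lambda>n. c (t (r n))) \<phi> sequentially"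
    using omega_set_subsequence[OF t(1)] by blast
  have lim: "\<phi> \<in> M" "(\<lambda>n. d (c (t (r n))) \<phi>) \<longlonglongrightarrow> 0"
    using r(3) unfolding limitin_metric_dist_null by auto
  have "(\<lambda>n. d (\<sigma> (r n)) \<phi>) \<longlonglongrightarrow> 0"
  proof (rule tendsto_sandwich[OF _ _ tendsto_const])
    show "\<forall>\<^sub>F n in sequentially. 0 \<le> d (\<sigma> (r n)) \<phi>" by simp
    have "d (\<sigma> (r n)) \<phi> \<le> 1 / real (Suc (r n)) + d (c (t (r n))) \<phi>" for n
      using triangle[OF \<sigma>M[of "r n"] _ lim(1), of "c (t (r n))"] t(2)[of "r n"] by (simp del: of_nat_Suc)
    then show "\<forall>\<^sub>F n in sequentially. d (\<sigma> (r n)) \<phi> \<le> 1 / real (Suc (r n)) + d (c (t (r n))) \<phi>" by simp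
    have "(\<lambda>n. 1 / real (Suc (r n))) \<longlonglongrightarrow> 0"
      using LIMSEQ_subseq_LIMSEQ[OF LIMSEQ_Suc[OF lim_1_over_n] r(1)] by (simp add: comp_def)
    then show "(\<lambda>n. 1 / real (Suc (r n)) + d (c (t (r n))) \<phi>) \<longlonglongrightarrow> 0"
      using lim(2) by (rule tendsto_add_zero)
  qed
  then have "limitin mtopology (\<sigma> \<circ> r) \<phi> sequentially"
    unfolding limitin_metric_dist_null using lim(1) \<sigma>M by (simp add: comp_def)
  then show "\<exists>l r. l \<in> omega_set c \<and> strict_mono r \<and> limitin mtopology (\<sigma> \<circ> r) l sequentially"
    using r by blast
qed

text \<open>If the set split, normality would give disjoint open neighbourhoods of the two pieces. A
  late tail of the curve lies in their union and visits both, although it is connected.\<close>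

lemma connectedin_omega_set:
  assumes cont: "continuous_map (top_of_set {0..}) mtopology c"
  shows "connectedin mtopology (omega_set c)"
  unfolding connectedin_closedin
proof (intro conjI notI)
  show "omega_set c \<subseteq> topspace mtopology" unfolding omega_set_def by auto
  assume "\<exists>E1 E2. closedin mtopology E1 \<and> closedin mtopology E2 \<and> omega_set c \<subseteq> E1 \<union> E2 \<and>
      E1 \<inter> E2 \<inter> omega_set c = {} \<and> E1 \<inter> omega_set c \<noteq> {} \<and> E2 \<inter> omega_set c \<noteq> {}"
  then obtain E1 E2 where E: "closedin mtopology E1" "closedin mtopology E2" "omega_set c \<subseteq> E1 \<union> E2"
    "E1 \<inter> E2 \<inter> omega_set c = {}" "E1 \<inter> omega_set c \<noteq> {}" "E2 \<inter> omega_set c \<noteq> {}" by blast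
  \<comment> \<open>\<open>E1\<close> and \<open>E2\<close> are disjoint only inside the limit set;
    its closedness turns the traces into disjoint closed sets, to which normality applies.\<close>
  have "closedin mtopology (omega_set c)"
    by (rule compactin_imp_closedin[OF Hausdorff_space_mtopology compactin_omega_set])
  then have "closedin mtopology (E1 \<inter> omega_set c)" "closedin mtopology (E2 \<inter> omega_set c)"
    using E by auto
  moreover have "disjnt (E1 \<inter> omega_set c) (E2 \<inter> omega_set c)" using E(4) by (auto simp: disjnt_def)
  ultimately obtain U V where UV: "openin mtopology U" "openin mtopology V" "E1 \<inter> omega_set c \<subseteq> U"
    "E2 \<inter> omega_set c \<subseteq> V" "disjnt U V"
    using normal_space_mtopology unfolding normal_space_def by metis
  \<comment> \<open>Otherwise points of the curve outside \<open>U \<union> V\<close> at arbitrarily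
    late times would accumulate at a limit point, which lies in this open set.\<close>
  have "\<exists>T\<ge>0. \<forall>t\<ge>T. c t \<in> U \<union> V"
  proof (rule ccontr)
    assume "\<not> ?thesis"
    then have "\<exists>t. real n \<le> t \<and> c t \<notin> U \<union> V" for n by (meson of_nat_0_le_iff)
    then obtain t where t: "\<And>n. real n \<le> t n" "\<And>n. c (t n) \<notin> U \<union> V" by metis
    obtain r \<phi> where r: "\<phi> \<in> omega_set c" "limitin mtopology (\<lambda>n. c (t (r n))) \<phi> sequentially"
      using omega_set_subsequence[OF t(1)] by blast
    have "\<phi> \<in> U \<union> V" using r(1) E(3) UV(3,4) by blast
    moreover have "openin mtopology (U \<union> V)" using UV by (intro openin_Un)
    ultimately have "\<forall>\<^sub>F n in sequentially. c (t (r n)) \<in> U \<union> V" using r(2) unfolding limitin_def by blast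
    then show False using t(2) by simp
  qed
  then obtain T where T: "0 \<le> T" "\<And>t. T \<le> t \<Longrightarrow> c t \<in> U \<union> V" by blast
  have "connectedin (top_of_set {0..}) {T..}"
    using T(1) by (simp add: connectedin_subtopology)
  then have conn: "connectedin mtopology (c ` {T..})"
    by (rule connectedin_continuous_map_image[OF cont])
  have meets: "W \<inter> c ` {T..} \<noteq> {}" if W: "openin mtopology W" "E \<inter> omega_set c \<subseteq> W" "E \<inter> omega_set c \<noteq> {}" for W E
  proof -
    obtain \<phi> where "\<phi> \<in> omega_set c" "\<phi> \<in> W" using W by blast
    then obtain t where "T \<le> t" "c t \<in> W" using omega_set_approx[OF _ W(1)] by metis
    then show ?thesis by auto
  qed
  have "c ` {T..} \<subseteq> U \<union> V" using T(2) by auto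
  moreover have "U \<inter> V \<inter> c ` {T..} = {}" using UV(5) by (auto simp: disjnt_def)
  ultimately show False
    using conn UV(1,2) meets[OF UV(1,3) E(5)] meets[OF UV(2,4) E(6)] unfolding connectedin by blast
qed

end

end

section \<open>The flow as a curve of L^1 classes\<close>

lemma L1_class_eq:
  assumes "integrable \<mu> g" "integrable \<mu> h" "AE x in \<mu>. g x = h x"
  shows "L1_class \<mu> g = L1_class \<mu> h"
  unfolding L1_class_def by (rule equiv_class_eq[OF equiv_L1_rel]) (use assms in \<open>simp add: L1_rel_def\<close>)

lemma L1_dist_class:
  assumes "integrable \<mu> g" "integrable \<mu> h"
  shows "L1_dist \<mu> (L1_class \<mu> g) (L1_class \<mu> h) = (LINT x|\<mu>. \<bar>g x - h x\<bar>)"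
  using assms by (intro L1_dist_eq L1_class_in_space L1_class_self)

context confined_flow
begin

text \<open>The Lipschitz bound in time is uniform in \<open>x\<close>, so on a finite measure space
  it integrates to a Lipschitz bound in L^1.\<close>

lemma continuous_L1_class: "continuous_map (top_of_set {0..}) (L1_topology M) (\<lambda>t. L1_class M (w t))"
proof -
  interpret L1: Metric_space "L1_space M" "L1_dist M" by (rule Metric_space_L1)
  obtain K where K: "0 < K" "\<And>s t x. 0 \<le> s \<Longrightarrow> 0 \<le> t \<Longrightarrow> \<bar>w s x - w t x\<bar> \<le> K * \<bar>s - t\<bar>"
    using w_Lipschitz by metis
  let ?m = "measure M (space M)"
  show ?thesis
    unfolding L1_topology_def L1.continuous_map_to_metric
  proof (intro ballI allI impI)
    fix t e :: real assume t: "t \<in> topspace (top_of_set {0..})" and "0 < e"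
    let ?U = "{0..} \<inter> ball t (e / (K * ?m))"
    have "L1_class M (w s) \<in> L1.mball (L1_class M (w t)) e" if s: "s \<in> ?U" for s
    proof -
      have st: "0 \<le> s" "0 \<le> t" "\<bar>t - s\<bar> < e / (K * ?m)" using s t by (auto simp: dist_real_def)
      note i = integrable_w[OF st(2)] integrable_w[OF st(1)]
      have "(LINT x|M. \<bar>w t x - w s x\<bar>) \<le> (LINT x|M. K * \<bar>t - s\<bar>)"
        by (rule integral_mono) (use i K(2)[OF st(2,1)] in auto)
      also have "\<dots> = (K * ?m) * \<bar>t - s\<bar>" by simp
      also have "\<dots> < (K * ?m) * (e / (K * ?m))"
        using st(3) K(1) nonnull by (intro mult_strict_left_mono) auto
      also have "\<dots> = e" using K(1) nonnull by simp
      finally show ?thesis using i by (simp add: L1_dist_class L1_class_in_space)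
    qed
    moreover have "t \<in> ?U" using t \<open>0 < e\<close> K(1) nonnull by simp
    ultimately show "\<exists>U. openin (top_of_set {0..}) U \<and> t \<in> U \<and>
        (\<forall>s\<in>U. L1_class M (w s) \<in> L1.mball (L1_class M (w t)) e)"
      by (intro exI[of _ ?U] conjI openin_open_Int) auto
  qed
qed

lemma L1_convergent_subsequence:
  fixes t :: "nat \<Rightarrow> real"
  assumes t: "\<And>n. 0 \<le> t n"
  obtains r \<psi> where "strict_mono (r :: nat \<Rightarrow> nat)" "\<psi> \<in> borel_measurable M" "\<And>x. \<psi> x \<in> {s1..s2}"
    "\<And>x. (\<lambda>n. w (t (r n)) x) \<longlonglongrightarrow> \<psi> x"
    "limitin (L1_topology M) (\<lambda>n. L1_class M (w (t (r n)))) (L1_class M \<psi>) sequentially"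
proof -
  interpret L1: Metric_space "L1_space M" "L1_dist M" by (rule Metric_space_L1)
  obtain r :: "nat \<Rightarrow> nat" and \<psi> where r: "strict_mono r" "\<psi> \<in> borel_measurable M" "\<And>x. \<psi> x \<in> {s1..s2}"
    "\<And>x. (\<lambda>n. w (t (r n)) x) \<longlonglongrightarrow> \<psi> x"
    using convergent_subsequence[of t, OF t] by metis
  have i: "integrable M \<psi>"
    using integrable_bounded_comp[OF r(2) _ r(3), of "\<lambda>a. a"] by simp
  have iw: "integrable M (w (t n))" for n by (rule integrable_w[OF t])
  have "(\<lambda>n. LINT x|M. \<bar>w (t (r n)) x - \<psi> x\<bar>) \<longlonglongrightarrow> (LINT x|M. 0)"
  proof (rule integral_dominated_convergence[where w = "\<lambda>_. s2 - s1"])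
    show "(\<lambda>x. \<bar>w (t (r n)) x - \<psi> x\<bar>) \<in> borel_measurable M" for n
      using w_meas[OF t, of "r n"] r(2) by measurable
    show "AE x in M. (\<lambda>n. \<bar>w (t (r n)) x - \<psi> x\<bar>) \<longlonglongrightarrow> 0"
      using r(4) by (intro AE_I2 tendsto_rabs_zero LIM_zero)
    have "\<bar>w (t (r n)) x - \<psi> x\<bar> \<le> s2 - s1" for n x
      using w_range[OF t, of "r n" x] r(3)[of x] by auto
    then show "AE x in M. norm \<bar>w (t (r n)) x - \<psi> x\<bar> \<le> s2 - s1" for n by simp
  qed auto
  then have "limitin (L1_topology M) (\<lambda>n. L1_class M (w (t (r n)))) (L1_class M \<psi>) sequentially"
    unfolding L1_topology_def L1.limitin_metric_dist_null
    using i iw by (simp add: L1_class_in_space L1_dist_class)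
  then show ?thesis using that r by blast
qed

text \<open>An L^1 limit carries no pointwise convergence of its own. A further subsequence
  converges pointwise, uniqueness of limits identifies its class with \<open>\<phi>\<close>, and the
  conclusions carry over to any representative \<open>g\<close>.\<close>

lemma L1_limit_stationary:
  assumes t: "\<And>n. 0 \<le> t n" "filterlim t at_top sequentially"
    and lim: "limitin (L1_topology M) (\<lambda>n. L1_class M (w (t n))) \<phi> sequentially" and g: "g \<in> \<phi>"
  shows "AE x in M. s1 \<le> g x \<and> g x \<le> s2" "AE x in M. f (g x) - mean (\<lambda>y. f (g y)) = 0"
proof -
  interpret L1: Metric_space "L1_space M" "L1_dist M" by (rule Metric_space_L1)
  obtain r :: "nat \<Rightarrow> nat" and \<psi> where r: "strict_mono r" "\<psi> \<in> borel_measurable M" "\<And>x. \<psi> x \<in> {s1..s2}"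
    "\<And>x. (\<lambda>n. w (t (r n)) x) \<longlonglongrightarrow> \<psi> x"
    "limitin (L1_topology M) (\<lambda>n. L1_class M (w (t (r n)))) (L1_class M \<psi>) sequentially"
    using L1_convergent_subsequence[of t, OF t(1)] by metis
  have "limitin (L1_topology M) (\<lambda>n. L1_class M (w (t (r n)))) \<phi> sequentially"
    using limitin_subsequence[OF r(1) lim] by (simp add: comp_def)
  then have "\<phi> = L1_class M \<psi>"
    using r(5) unfolding L1_topology_def by (rule L1.limitin_metric_unique) simp
  then have eq: "AE x in M. \<psi> x = g x" and ig: "integrable M g"
    using g by (auto simp: L1_class_def L1_rel_def)
  have f_meas: "f \<in> borel_measurable borel" by (rule borel_measurable_continuous_onI[OF f_cont])
  have "(LINT y|M. f (\<psi> y)) = (LINT y|M. f (g y))"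
  proof (rule integral_cong_AE)
    show "(\<lambda>y. f (\<psi> y)) \<in> borel_measurable M" by (rule measurable_compose[OF r(2) f_meas])
    show "(\<lambda>y. f (g y)) \<in> borel_measurable M"
      by (rule measurable_compose[OF borel_measurable_integrable[OF ig] f_meas])
    show "AE y in M. f (\<psi> y) = f (g y)" using eq by eventually_elim simp
  qed
  then have mean_eq: "mean (\<lambda>y. f (\<psi> y)) = mean (\<lambda>y. f (g y))"
    unfolding mean_def by simp
  have "filterlim (\<lambda>n. t (r n)) at_top sequentially"
    by (rule filterlim_compose[OF t(2) filterlim_subseq[OF r(1)]])
  then have "AE x in M. f (\<psi> x) - mean (\<lambda>y. f (\<psi> y)) = 0"
    using limit_stationary[of "\<lambda>n. t (r n)", OF t(1) _ r(2,4)] by blast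
  then show "AE x in M. f (g x) - mean (\<lambda>y. f (g y)) = 0"
    using eq unfolding mean_eq by eventually_elim simp
  show "AE x in M. s1 \<le> g x \<and> g x \<le> s2"
    using eq
  proof eventually_elim
    case (elim x)
    then show ?case using r(3)[of x] by simp
  qed
qed

end

section \<open>Stationarity of the limit set\<close>

text \<open>\<open>f\<close> falls, rises and falls again, so the only competitors of
  \<open>f c\<close> are the local maximum \<open>f M\<close> to the right of \<open>c\<close> and
  the local minimum \<open>f m\<close> to its left. The levels \<open>s_low\<close> and
  \<open>s_up\<close> are where the outer branches reach these two values.\<close>

lemma outside_hysteresis_extremal:
  fixes f f' :: "real \<Rightarrow> real"
  assumes deriv: "\<And>s. (f has_real_derivative f' s) (at s)"
    and crit: "f' m = 0" "f' M = 0" "m < M"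
    and neg: "\<And>s. s \<in> {..<m} \<union> {M<..} \<Longrightarrow> f' s < 0"
    and pos: "\<And>s. s \<in> {m<..<M} \<Longrightarrow> f' s > 0"
    and hyst: "s_low < m" "M < s_up" "f s_low = f M" "f s_up = f m"
    and c: "c \<notin> {s_low<..<s_up}"
  shows "c \<le> s \<Longrightarrow> f s \<le> f c" and "s \<le> c \<Longrightarrow> f c \<le> f s"
proof -
  have left: "f b \<le> f a" if "a \<le> b" "b \<le> m" for a b
  proof (rule DERIV_nonpos_imp_nonincreasing[OF that(1)])
    fix x assume "a \<le> x" "x \<le> b"
    then have "f' x \<le> 0" using neg[of x] crit(1) that by (cases "x = m") auto
    then show "\<exists>y. (f has_real_derivative y) (at x) \<and> y \<le> 0" using deriv by blast
  qed
  have right: "f b \<le> f a" if "a \<le> b" "M \<le> a" for a b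
  proof (rule DERIV_nonpos_imp_nonincreasing[OF that(1)])
    fix x assume "a \<le> x" "x \<le> b"
    then have "f' x \<le> 0" using neg[of x] crit(2) that by (cases "x = M") auto
    then show "\<exists>y. (f has_real_derivative y) (at x) \<and> y \<le> 0" using deriv by blast
  qed
  have middle: "f a \<le> f b" if "a \<le> b" "m \<le> a" "b \<le> M" for a b
  proof (rule DERIV_nonneg_imp_nondecreasing[OF that(1)])
    fix x assume "a \<le> x" "x \<le> b"
    then have "0 \<le> f' x" using pos[of x] crit that by (cases "x = m \<or> x = M") auto
    then show "\<exists>y. (f has_real_derivative y) (at x) \<and> 0 \<le> y" using deriv by blast
  qed
  show "f s \<le> f c" if "c \<le> s"
  proof (cases "s_up \<le> c")
    case True
    then show ?thesis using right[of c s] that hyst by simp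
  next
    case False
    then have "c \<le> s_low" using c by auto
    then have "f s_low \<le> f c" using left[of c s_low] hyst by simp
    moreover have "f s \<le> f c" if "s \<le> m" using left[of c s] \<open>c \<le> s\<close> that by simp
    moreover have "f s \<le> f M" if "m < s" using middle[of s M] right[of M s] that by (cases "s \<le> M") auto
    ultimately show ?thesis using hyst by fastforce
  qed
  show "f c \<le> f s" if "s \<le> c"
  proof (cases "c \<le> s_low")
    case True
    then show ?thesis using left[of s c] that hyst by simp
  next
    case False
    then have "s_up \<le> c" using c by auto
    then have "f c \<le> f s_up" using right[of s_up c] hyst by simp
    moreover have "f c \<le> f s" if "M \<le> s" using right[of s c] \<open>s \<le> c\<close> that by simp
    moreover have "f m \<le> f s" if "s < M" using middle[of m s] left[of s m] that by (cases "m \<le> s") auto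
    ultimately show ?thesis using hyst by fastforce
  qed
qed

theorem theorem1p3:
  fixes \<Omega> :: "(real ^ 'n) set"
    and f f' :: "real \<Rightarrow> real"
    and m M s_low s_up s1 s2 :: real
    and u0 :: "real ^ 'n \<Rightarrow> real"
    and u :: "real \<Rightarrow> real ^ 'n \<Rightarrow> real"
  assumes "open \<Omega>" and "bounded \<Omega>" and "\<Omega> \<noteq> {}"
    and "\<And>s. (f has_real_derivative f' s) (at s)" and "continuous_on UNIV f'"
    and "m < M" and "f' m = 0" and "f' M = 0"
    and "\<And>s. s \<in> {..<m} \<union> {M<..} \<Longrightarrow> f' s < 0"
    and "\<And>s. s \<in> {m<..<M} \<Longrightarrow> f' s > 0"
    and "s_low < m" and "M < s_up" and "f s_low = f M" and "f s_up = f m"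
    and "u0 \<in> Linf (lebesgue_on \<Omega>)"
    and "s1 < s2" and "s1 \<notin> {s_low<..<s_up}" and "s2 \<notin> {s_low<..<s_up}"
    and "AE x in lebesgue_on \<Omega>. s1 \<le> u0 x \<and> u0 x \<le> s2"
    and "solves_P \<Omega> f u0 u"
  shows "omega_limit \<Omega> u \<noteq> {} \<and>
         compactin (L1_topology (lebesgue_on \<Omega>)) (omega_limit \<Omega> u) \<and>
         connectedin (L1_topology (lebesgue_on \<Omega>)) (omega_limit \<Omega> u) \<and>
         (\<forall>\<phi>\<in>omega_limit \<Omega> u. \<forall>g\<in>\<phi>.
            (AE x in lebesgue_on \<Omega>. s1 \<le> g x \<and> g x \<le> s2) \<and>
            (AE x in lebesgue_on \<Omega>. f (g x) - avg \<Omega> (\<lambda>y. f (g y)) = 0))"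
proof -
  let ?M = "lebesgue_on \<Omega>"
  have \<Omega>_fin: "\<Omega> \<in> lmeasurable" using \<open>bounded \<Omega>\<close> \<open>open \<Omega>\<close> by (rule lmeasurable_open)
  then have \<Omega>_sets: "\<Omega> \<in> sets lebesgue" by (rule fmeasurableD)
  have em: "emeasure ?M (space ?M) = emeasure lebesgue \<Omega>"
    using \<Omega>_sets by (simp add: emeasure_restrict_space)
  interpret finite_measure ?M
    by standard (use \<Omega>_fin em in \<open>auto simp: fmeasurable_def\<close>)
  have nonnull: "emeasure ?M (space ?M) \<noteq> 0"
    using open_not_negligible[OF \<open>open \<Omega>\<close> \<open>\<Omega> \<noteq> {}\<close>] \<Omega>_sets unfolding em
    by (auto simp: negligible_iff_null_sets null_sets_def)
  then have nonnull': "0 < measure ?M (space ?M)"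
    by (simp add: emeasure_eq_measure zero_less_measure_iff)
  have avg_eq: "avg \<Omega> g = mean g" for g
    unfolding avg_def mean_def using em by (simp add: measure_def)
  have f_cont: "continuous_on UNIV f"
    by (intro continuous_at_imp_continuous_on ballI DERIV_isCont[OF assms(4)])
  have u: "u t \<in> Linf ?M" if "0 \<le> t" for t
    using \<open>solves_P \<Omega> f u0 u\<close> that unfolding solves_P_def by blast
  obtain v where sol: "\<forall>t\<ge>0. v t \<in> Linf ?M \<and> Linf_has_deriv ?M u (v t) t \<and> Linf_tendsto ?M v (v t) (at t within {0..})"
      "\<forall>t>0. AE x in ?M. v t x = f (u t x) - avg \<Omega> (\<lambda>y. f (u t y))"
    using \<open>solves_P \<Omega> f u0 u\<close> unfolding solves_P_def by blast
  have v: "\<And>t. 0 \<le> t \<Longrightarrow> v t \<in> Linf ?M" "\<And>t. 0 \<le> t \<Longrightarrow> Linf_has_deriv ?M u (v t) t"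
      "\<And>t. 0 \<le> t \<Longrightarrow> Linf_tendsto ?M v (v t) (at t within {0..})"
      "\<And>t. 0 < t \<Longrightarrow> AE x in ?M. v t x = f (u t x) - 1 / measure ?M (space ?M) * (LINT y|?M. f (u t y))"
    using sol unfolding avg_eq mean_def by blast+
  have "AE x in ?M. u 0 x = u0 x" using \<open>solves_P \<Omega> f u0 u\<close> unfolding solves_P_def by blast
  then have init: "AE x in ?M. u 0 x \<in> {s1..s2}"
    using assms(19) by eventually_elim simp
  obtain w where w: "\<And>t. 0 \<le> t \<Longrightarrow> w t \<in> borel_measurable ?M"
    "\<And>t. 0 \<le> t \<Longrightarrow> AE x in ?M. w t x = u t x"
    "\<And>x t. 0 < t \<Longrightarrow> ((\<lambda>t. w t x) has_real_derivative f (w t x) - 1 / measure ?M (space ?M) * (LINT y|?M. f (w t y))) (at t)"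
    "\<And>x. continuous_on {0..} (\<lambda>t. w t x)"
    "\<And>T. \<exists>C. \<forall>t\<in>{0..T}. \<forall>x. \<bar>w t x\<bar> \<le> C"
    "\<And>x. w 0 x \<in> {s1..s2}"
    by (rule Linf_solution_pathwise[OF nonnull f_cont u v init]) (assumption | rule that | blast)+
  note extremal = outside_hysteresis_extremal[where f' = f', OF _ assms(7,8,6) _ _ assms(11-14)]
  have f_le: "f s \<le> f s1" if "s1 \<le> s" for s
    by (rule extremal(1)) (use assms(4,9,10,17) that in auto)
  have f_ge: "f s2 \<le> f s" if "s \<le> s2" for s
    by (rule extremal(2)) (use assms(4,9,10,18) that in auto)
  interpret confined_flow ?M f f' s1 s2 w
  proof
    show "((\<lambda>t. w t x) has_real_derivative f (w t x) - mean (\<lambda>y. f (w t y))) (at t)" if "0 < t" for x t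
      using w(3)[OF that] by (simp add: mean_def)
  qed (fact nonnull' assms(4) assms(5) f_le f_ge w)+
  interpret L1: Metric_space "L1_space ?M" "L1_dist ?M" by (rule Metric_space_L1)
  let ?c = "\<lambda>t. L1_class ?M (w t)"
  have class_eq: "L1_class ?M (u t) = ?c t" if "0 \<le> t" for t
    by (rule sym, rule L1_class_eq[OF integrable_w[OF that] integrable_Linf[OF u[OF that]] w(2)[OF that]])
  \<comment> \<open>The classes of \<open>u\<close> and \<open>w\<close> agree at nonnegative times,
    and only such times enter the limit set, so the general results may be applied to
    \<open>w\<close>.\<close>
  have omega: "omega_limit \<Omega> u = L1.omega_set ?c"
  proof -
    have "(\<lambda>n. L1_class ?M (u (t n))) = (\<lambda>n. ?c (t n))" if "\<forall>n. 0 \<le> t n" for t :: "nat \<Rightarrow> real"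
      using class_eq that by blast
    then show ?thesis
      unfolding omega_limit_def L1.omega_set_def L1_topology_def
      by (intro Collect_cong conj_cong ex_cong1 refl) auto
  qed
  have precompact: "\<exists>r \<phi>. strict_mono r \<and> limitin L1.mtopology (\<lambda>n. ?c (t (r n))) \<phi> sequentially"
    if "\<And>n. 0 \<le> t n" for t :: "nat \<Rightarrow> real"
    using L1_convergent_subsequence[of t, OF that] unfolding L1_topology_def by metis
  have stationary: "(AE x in ?M. s1 \<le> g x \<and> g x \<le> s2) \<and> (AE x in ?M. f (g x) - avg \<Omega> (\<lambda>y. f (g y)) = 0)"
    if "\<phi> \<in> L1.omega_set ?c" "g \<in> \<phi>" for \<phi> g
  proof -
    have "\<exists>t :: nat \<Rightarrow> real. (\<forall>n. 0 \<le> t n) \<and> filterlim t at_top sequentially \<and>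
        limitin (L1_topology ?M) (\<lambda>n. ?c (t n)) \<phi> sequentially"
      using that(1) unfolding L1.omega_set_def L1_topology_def mem_Collect_eq by (rule conjunct2)
    then obtain t :: "nat \<Rightarrow> real" where t: "(\<forall>n. 0 \<le> t n) \<and> filterlim t at_top sequentially \<and>
        limitin (L1_topology ?M) (\<lambda>n. ?c (t n)) \<phi> sequentially" ..
    then show ?thesis
      unfolding avg_eq using L1_limit_stationary[of t \<phi> g] t that(2) by simp
  qed
  have "connectedin L1.mtopology (L1.omega_set ?c)"
    by (rule L1.connectedin_omega_set[OF precompact]) (use continuous_L1_class in \<open>simp_all add: L1_topology_def\<close>)
  moreover have "L1.omega_set ?c \<noteq> {}" by (rule L1.omega_set_nonempty[OF precompact])
  moreover have "compactin L1.mtopology (L1.omega_set ?c)" by (rule L1.compactin_omega_set[OF precompact])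
  ultimately show ?thesis
    unfolding omega L1_topology_def using stationary by (intro conjI ballI) simp_all
qed

end
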